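(* A poset is geometric if and only if it is isomorphic to the poset of flats $F(\mathscr{M})$ of some matroid scheme $\mathscr{M}$. Furthermore, each geometric poset is the poset of flats of a unique simple matroid scheme, up to isomorphism of matroid schemes.
   Context: A finite poset $S$ is a simplicial poset if it has a unique minimum $\hat 0$, is ranked (there is an order-preserving rank function with $\mathrm{rank}(\hat0)=0$ increasing by one along cover relations), and for every $x\in S$ the lower interval $S_{\le x}=\{y\in S: y\le x\}$ is isomorphic to the Boolean lattice of all subsets of the set of atoms (rank-one elements) lying below $x$. Write $|x|$ for the rank of $x$ and $\mathrm{at}(S)$ for the set of atoms. For $T\subseteq S$, $\bigvee T$ denotes the set of minimal common upper bounds of $T$ and $\bigwedge T$ the set of maximal common lower bounds; $x\vee y:=\bigvee\{x,y\}$, $x\wedge y:=\bigwedge\{x,y\}$ (if $x\vee y\ne\emptyset$ then $x\wedge y$ has exactly one element, also denoted $x\wedge y$). A matroid scheme is a pair $(S,\rho)$ with $S$ a finite simplicial poset and $\rho:S\to\mathbb{Z}_{\ge0}$ such that: (M1) $0\le\rho(x)\le|x|$; (M2) $x\le y$ implies $\rho(x)\le\rho(y)$; (M3) if $u\in x\vee y$ then $\rho(x)+\rho(y)\ge\rho(u)+\rho(x\wedge y)$; (M4) if $\ell\in x\wedge y$ and $\rho(x)=\rho(\ell)$ then $x\vee y\ne\emptyset$; (M5) if $\rho(x)<\rho(y)$ then there is $a\in\mathrm{at}(S)$ with $a\le y$, $a\not\le x$ and $x\vee a\ne\emptyset$. Two matroid schemes $(S,\rho),(S',\rho')$ are isomorphic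 if there is a poset isomorphism $\phi:S\to S'$ with $\rho'(\phi(x))=\rho(x)$. For $x\in S$, the closure $\mathrm{cl}(x)$ is the unique maximal element of $\{y\in S: y\ge x,\ \rho(y)=\rho(x)\}$; $x$ is a flat if $\mathrm{cl}(x)=x$, and the poset of flats $F(\mathscr{M})$ is the subposet of flats (ranked by $\rho$). An atom $a$ is a loop if $\rho(a)=0$. A matroid scheme is simple if every atom is a flat and not a loop. A geometric poset is a poset $P$ with a unique minimum $\hat0$, ranked by a function $\rho$, such that (G1) for every maximal element $m$ of $P$ the interval $P_{\le m}$ is a geometric lattice, and (G2) for every $x\in P$, every set $A$ of atoms of $P$, and every $y\in\bigvee A$ with $\rho(x)<\rho(y)=|A|$, there exists $a\in A$ with $a\not\le x$ and $a\vee x\ne\emptyset$.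
   Formalization: The poset is assumed finite: a minimum with infinitely many atoms is geometric by the stated definition, but matroid schemes are finite, so it is not a poset of flats; posets of flats are always finite. *)

theory Defs
  imports "HOL-Algebra.Complete_Lattice"
begin

text \<open>
  Posets are the records of type \<^typ>\<open>'a gorder\<close> satisfying \<^const>\<open>partial_order\<close>, with
  elements \<open>carrier L\<close> and order \<open>\<sqsubseteq>\<^bsub>L\<^esub>\<close>. A subposet is obtained by updating the carrier.
\<close>

section \<open>Finite posets\<close>

definition poset_iso :: "('a, 'c) gorder_scheme \<Rightarrow> ('b, 'd) gorder_scheme \<Rightarrow> ('a \<Rightarrow> 'b) \<Rightarrow> bool"
  where "poset_iso A B f \<longleftrightarrow> bij_betw f (carrier A) (carrier B) \<and> order_emb A B f"

definition poset_isomorphic :: "('a, 'c) gorder_scheme \<Rightarrow> ('b, 'd) gorder_scheme \<Rightarrow> bool"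
  where "poset_isomorphic A B \<longleftrightarrow> (\<exists>f. poset_iso A B f)"

definition minimals :: "('a, 'c) gorder_scheme \<Rightarrow> 'a set \<Rightarrow> 'a set"
  where "minimals L X = {u \<in> X. \<forall>v\<in>X. v \<sqsubseteq>\<^bsub>L\<^esub> u \<longrightarrow> v = u}"

definition maximals :: "('a, 'c) gorder_scheme \<Rightarrow> 'a set \<Rightarrow> 'a set"
  where "maximals L X = {u \<in> X. \<forall>v\<in>X. u \<sqsubseteq>\<^bsub>L\<^esub> v \<longrightarrow> v = u}"

text \<open>
  The set-valued join \<open>\<Or>T\<close> and meet \<open>\<And>T\<close>. They must not be confused with the
  library's operations \<open>\<Squnion>\<close> and \<open>\<Sqinter>\<close>, which select a least upper or greatest lower bound.
\<close>

definition joins :: "('a, 'c) gorder_scheme \<Rightarrow> 'a set \<Rightarrow> 'a set"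
  where "joins L T = minimals L (Upper L T)"

definition meets :: "('a, 'c) gorder_scheme \<Rightarrow> 'a set \<Rightarrow> 'a set"
  where "meets L T = maximals L (Lower L T)"

definition below :: "('a, 'c) gorder_scheme \<Rightarrow> 'a \<Rightarrow> ('a, 'c) gorder_scheme"
  where "below L x = L\<lparr>carrier := {y \<in> carrier L. y \<sqsubseteq>\<^bsub>L\<^esub> x}\<rparr>"

definition covers :: "('a, 'c) gorder_scheme \<Rightarrow> 'a \<Rightarrow> 'a \<Rightarrow> bool"
  where "covers L x y \<longleftrightarrow> x \<sqsubset>\<^bsub>L\<^esub> y \<and> \<not> (\<exists>z\<in>carrier L. x \<sqsubset>\<^bsub>L\<^esub> z \<and> z \<sqsubset>\<^bsub>L\<^esub> y)"

definition rank_function :: "('a, 'c) gorder_scheme \<Rightarrow> ('a \<Rightarrow> nat) \<Rightarrow> bool"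
  where "rank_function L r \<longleftrightarrow>
    r \<bottom>\<^bsub>L\<^esub> = 0 \<and>
    (\<forall>x\<in>carrier L. \<forall>y\<in>carrier L. x \<sqsubseteq>\<^bsub>L\<^esub> y \<longrightarrow> r x \<le> r y) \<and>
    (\<forall>x\<in>carrier L. \<forall>y\<in>carrier L. covers L x y \<longrightarrow> r y = Suc (r x))"

text \<open>
  In a finite poset with a minimum, a rank function is uniquely determined on the carrier, so
  the choice below is immaterial there.
\<close>

definition poset_rank :: "('a, 'c) gorder_scheme \<Rightarrow> 'a \<Rightarrow> nat"
  where "poset_rank L = (SOME r. rank_function L r)"

locale ranked_poset = partial_order L + weak_partial_order_bottom L for L (structure) +
  assumes ranked: "\<exists>r. rank_function L r"

definition atoms :: "('a, 'c) gorder_scheme \<Rightarrow> 'a set"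
  where "atoms L = {a \<in> carrier L. poset_rank L a = 1}"

section \<open>Matroid schemes\<close>

locale simplicial_poset = ranked_poset S for S (structure) +
  assumes finite_carrier: "finite (carrier S)"
    and boolean_intervals: "\<And>x. x \<in> carrier S \<Longrightarrow>
      poset_isomorphic (below S x)
        \<lparr>carrier = Pow {a \<in> atoms S. a \<sqsubseteq> x}, eq = (=), le = (\<subseteq>)\<rparr>"

text \<open>
  In \<open>M3\<close> the set \<open>meets S {x, y}\<close> is a singleton, because the join of \<open>x\<close> and \<open>y\<close> is nonempty.
\<close>

locale matroid_scheme = simplicial_poset S for S (structure) +
  fixes \<rho> :: "'a \<Rightarrow> nat"
  assumes M1: "\<And>x. x \<in> carrier S \<Longrightarrow> \<rho> x \<le> poset_rank S x"
    and M2: "\<And>x y. \<lbrakk>x \<in> carrier S; y \<in> carrier S; x \<sqsubseteq> y\<rbrakk> \<Longrightarrow> \<rho> x \<le> \<rho> y"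
    and M3: "\<And>x y u. \<lbrakk>x \<in> carrier S; y \<in> carrier S; u \<in> joins S {x, y}\<rbrakk> \<Longrightarrow>
      \<rho> x + \<rho> y \<ge> \<rho> u + \<rho> (the_elem (meets S {x, y}))"
    and M4: "\<And>x y l. \<lbrakk>x \<in> carrier S; y \<in> carrier S; l \<in> meets S {x, y}; \<rho> x = \<rho> l\<rbrakk> \<Longrightarrow>
      joins S {x, y} \<noteq> {}"
    and M5: "\<And>x y. \<lbrakk>x \<in> carrier S; y \<in> carrier S; \<rho> x < \<rho> y\<rbrakk> \<Longrightarrow>
      \<exists>a\<in>atoms S. a \<sqsubseteq> y \<and> \<not> a \<sqsubseteq> x \<and> joins S {x, a} \<noteq> {}"

definition matroid_scheme_isomorphic ::
    "'a gorder \<Rightarrow> ('a \<Rightarrow> nat) \<Rightarrow> 'b gorder \<Rightarrow> ('b \<Rightarrow> nat) \<Rightarrow> bool"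
  where "matroid_scheme_isomorphic S \<rho> S' \<rho>' \<longleftrightarrow>
    (\<exists>\<phi>. poset_iso S S' \<phi> \<and> (\<forall>x\<in>carrier S. \<rho>' (\<phi> x) = \<rho> x))"

definition closure :: "'a gorder \<Rightarrow> ('a \<Rightarrow> nat) \<Rightarrow> 'a \<Rightarrow> 'a"
  where "closure S \<rho> x =
    (THE z. z \<in> maximals S {y \<in> carrier S. x \<sqsubseteq>\<^bsub>S\<^esub> y \<and> \<rho> y = \<rho> x})"

definition flats :: "'a gorder \<Rightarrow> ('a \<Rightarrow> nat) \<Rightarrow> 'a set"
  where "flats S \<rho> = {x \<in> carrier S. closure S \<rho> x = x}"

definition flat_poset :: "'a gorder \<Rightarrow> ('a \<Rightarrow> nat) \<Rightarrow> 'a gorder"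
  where "flat_poset S \<rho> = S\<lparr>carrier := flats S \<rho>\<rparr>"

definition loop :: "'a gorder \<Rightarrow> ('a \<Rightarrow> nat) \<Rightarrow> 'a \<Rightarrow> bool"
  where "loop S \<rho> a \<longleftrightarrow> a \<in> atoms S \<and> \<rho> a = 0"

definition simple_matroid_scheme :: "'a gorder \<Rightarrow> ('a \<Rightarrow> nat) \<Rightarrow> bool"
  where "simple_matroid_scheme S \<rho> \<longleftrightarrow>
    matroid_scheme S \<rho> \<and> (\<forall>a\<in>atoms S. a \<in> flats S \<rho> \<and> \<not> loop S \<rho> a)"

section \<open>Geometric posets\<close>

text \<open>A geometric lattice is a finite lattice that is atomistic and (upper) semimodular.\<close>

locale geometric_lattice = lattice L + ranked_poset L for L (structure) +
  assumes finite_lattice: "finite (carrier L)"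
    and atomistic: "\<And>x. x \<in> carrier L \<Longrightarrow> \<exists>A\<subseteq>atoms L. x = \<Squnion>A"
    and semimodular: "\<And>x y. \<lbrakk>x \<in> carrier L; y \<in> carrier L\<rbrakk> \<Longrightarrow>
      poset_rank L x + poset_rank L y \<ge> poset_rank L (x \<squnion> y) + poset_rank L (x \<sqinter> y)"

locale geometric_poset = ranked_poset P for P (structure) +
  assumes G1: "\<And>m. m \<in> maximals P (carrier P) \<Longrightarrow> geometric_lattice (below P m)"
    and G2: "\<And>x A y. \<lbrakk>x \<in> carrier P; A \<subseteq> atoms P; y \<in> joins P A;
        poset_rank P x < poset_rank P y; poset_rank P y = card A\<rbrakk> \<Longrightarrow>
      \<exists>a\<in>A. \<not> a \<sqsubseteq> x \<and> joins P {a, x} \<noteq> {}"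

end

theory Submission
  imports Defs
begin

text \<open>
  In a matroid scheme the axioms M3 and M4 make \<open>{y \<ge> x. \<rho> y = \<rho> x}\<close> directed, so closures exist,
  are monotone, and preserve \<open>\<rho>\<close>. Inside a lower interval the flats are those of an ordinary matroid,
  which gives G1. For G2, pick a non-loop atom of the scheme below each flat in \<open>A\<close>: the element they
  span below \<open>y\<close> has closure \<open>y\<close>, and M5 applied to it yields the required member of \<open>A\<close>.

  Conversely, the pairs \<open>(A, y)\<close> of a set of atoms of a geometric poset and one of its joins, with
  \<open>\<rho> (A, y) = rank y\<close>, form a simple matroid scheme, because the joins of \<open>A\<close> below a fixed element
  are unique. In any simple matroid scheme with the given flats, an element is determined by its
  atoms (which are flats) and its closure, and every pair of the above kind occurs. This is
  uniqueness.
\<close>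

section \<open>Finite posets and their rank functions\<close>

text \<open>The obstacle throughout is that two elements may have several minimal upper bounds or
  none. Atom sets and closures decide the order only below a common upper bound, so many arguments
  first produce one: in a scheme from M4 or from a closure, in a geometric poset from a fixed
  element whose lower interval is a lattice. The Boolean isomorphisms of a simplicial poset are
  abstract. They are traded for labels once and for all: a given scheme is labelled by its atoms,
  the constructed one by the first coordinates of its pairs, and the same lemmas on joins and meets
  then serve both. The equation between rank and cardinality in G2 says that \<open>A\<close> is a
  basis of \<open>y\<close>. Semimodularity extracts such a basis from any set of atoms, which is
  how M5 is brought within reach of G2 and how M1 is obtained. The two halves share the predicate
  \<open>encodes\<close>: existence equips a copy of the set of pairs with it, and uniqueness shows
  that every simple scheme with the given flats satisfies it.\<close>

lemma below_simps [simp]: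
  "carrier (below L x) = {y \<in> carrier L. y \<sqsubseteq>\<^bsub>L\<^esub> x}"
  "le (below L x) = le L"
  "eq (below L x) = eq L"
  by (simp_all add: below_def)

lemma flat_poset_simps [simp]:
  "carrier (flat_poset S \<rho>) = flats S \<rho>"
  "le (flat_poset S \<rho>) = le S"
  "eq (flat_poset S \<rho>) = eq S"
  by (simp_all add: flat_poset_def)

lemma partial_order_subset:
  assumes "partial_order L" "A \<subseteq> carrier L"
  shows "partial_order (L\<lparr>carrier := A\<rparr>)"
proof -
  interpret L: partial_order L by fact
  interpret W: weak_partial_order "L\<lparr>carrier := A\<rparr>"
    using weak_partial_order_subset L.weak_partial_order_axioms assms(2) by blast
  show ?thesis
    by unfold_locales (simp add: L.eq_is_equal)
qed

locale finite_pointed_poset = partial_order L + weak_partial_order_bottom L for L (structure) +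
  assumes finite_poset: "finite (carrier L)"
begin

lemma strict_order_on:
  assumes "X \<subseteq> carrier L"
  shows "asymp_on X (\<sqsubset>)" and "transp_on X (\<sqsubset>)"
proof -
  show "asymp_on X (\<sqsubset>)"
    by (rule asymp_onI) (use assms in \<open>auto simp: lless_eq\<close>)
  show "transp_on X (\<sqsubset>)"
    using assms lless_trans by (intro transp_onI) (meson subsetD)
qed

lemma minimals_below:
  assumes "X \<subseteq> carrier L" "x \<in> X"
  shows "\<exists>u\<in>minimals L X. u \<sqsubseteq> x"
proof -
  let ?Y = "{v \<in> X. v \<sqsubseteq> x}"
  have Y: "?Y \<subseteq> carrier L" "x \<in> ?Y" using assms by auto
  then have "finite ?Y" "?Y \<noteq> {}" using finite_poset finite_subset by blast+
  moreover have "asymp_on ?Y (\<sqsubset>)" "transp_on ?Y (\<sqsubset>)"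
    using strict_order_on[OF Y(1)] by auto
  ultimately obtain u where u: "u \<in> ?Y" "\<forall>v\<in>?Y. v \<noteq> u \<longrightarrow> \<not> v \<sqsubset> u"
    using Finite_Set.bex_min_element[of ?Y "(\<sqsubset>)"] by blast
  have "v = u" if v: "v \<in> X" "v \<sqsubseteq> u" for v
  proof -
    have "v \<sqsubseteq> x" using v u assms le_trans[of v u x] by blast
    then show ?thesis using u v by (auto simp: lless_eq)
  qed
  then have "u \<in> minimals L X" using u by (simp add: minimals_def)
  with u show ?thesis by blast
qed

lemma maximals_above:
  assumes "X \<subseteq> carrier L" "x \<in> X"
  shows "\<exists>u\<in>maximals L X. x \<sqsubseteq> u"
proof -
  let ?Y = "{v \<in> X. x \<sqsubseteq> v}"
  have Y: "?Y \<subseteq> carrier L" "x \<in> ?Y" using assms by auto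
  then have "finite ?Y" "?Y \<noteq> {}" using finite_poset finite_subset by blast+
  moreover have "asymp_on ?Y (\<sqsubset>)" "transp_on ?Y (\<sqsubset>)"
    using strict_order_on[OF Y(1)] by auto
  ultimately obtain u where u: "u \<in> ?Y" "\<forall>v\<in>?Y. v \<noteq> u \<longrightarrow> \<not> u \<sqsubset> v"
    using Finite_Set.bex_max_element[of ?Y "(\<sqsubset>)"] by blast
  have "v = u" if v: "v \<in> X" "u \<sqsubseteq> v" for v
  proof -
    have "x \<sqsubseteq> v" using v u assms le_trans[of x u v] by blast
    then show ?thesis using u v by (auto simp: lless_eq)
  qed
  then have "u \<in> maximals L X" using u by (simp add: maximals_def)
  with u show ?thesis by blast
qed

lemma maximal_above: "x \<in> carrier L \<Longrightarrow> \<exists>m\<in>maximals L (carrier L). x \<sqsubseteq> m"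
  using maximals_above by blast

lemma joins_below:
  assumes "u \<in> Upper L T"
  shows "\<exists>v\<in>joins L T. v \<sqsubseteq> u"
  unfolding joins_def using minimals_below[OF Upper_closed assms] .

lemma upper_cover:
  assumes "x \<in> carrier L" "y \<in> carrier L" "x \<sqsubset> y"
  shows "\<exists>z\<in>carrier L. covers L x z \<and> z \<sqsubseteq> y"
proof -
  have "\<exists>u\<in>minimals L {z \<in> carrier L. x \<sqsubset> z}. u \<sqsubseteq> y"
    using assms by (intro minimals_below) auto
  then obtain u where u: "u \<in> minimals L {z \<in> carrier L. x \<sqsubset> z}" "u \<sqsubseteq> y" by blast
  then have "covers L x u" "u \<in> carrier L"
    by (auto simp: minimals_def covers_def lless_eq)
  with u show ?thesis by blast
qed

lemma lower_cover:
  assumes "x \<in> carrier L" "y \<in> carrier L" "x \<sqsubset> y"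
  shows "\<exists>z\<in>carrier L. covers L z y \<and> x \<sqsubseteq> z"
proof -
  have "\<exists>u\<in>maximals L {z \<in> carrier L. z \<sqsubset> y}. x \<sqsubseteq> u"
    using assms by (intro maximals_above) auto
  then obtain u where u: "u \<in> maximals L {z \<in> carrier L. z \<sqsubset> y}" "x \<sqsubseteq> u" by blast
  then have "covers L u y" "u \<in> carrier L"
    by (auto simp: maximals_def covers_def lless_eq)
  with u show ?thesis by blast
qed

text \<open>A rank function is only weakly monotone by definition; finiteness supplies a cover of
  \<open>x\<close> below \<open>y\<close>, where the value jumps.\<close>

lemma rank_function_strict:
  assumes r: "rank_function L r" and x: "x \<in> carrier L" and y: "y \<in> carrier L" and "x \<sqsubset> y"
  shows "r x < r y"
proof -
  obtain z where z: "z \<in> carrier L" "covers L x z" "z \<sqsubseteq> y"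
    using upper_cover assms by blast
  then have "r z = Suc (r x)" "r z \<le> r y"
    using r x y by (auto simp: rank_function_def)
  then show ?thesis by simp
qed

text \<open>Descending along a lower cover reduces to \<open>\<bottom>\<close>. This makes the
  choice in \<open>poset_rank\<close> harmless, so any rank function at hand may be used to compute
  it.\<close>

lemma rank_function_unique:
  assumes r: "rank_function L r" and s: "rank_function L s" and "x \<in> carrier L"
  shows "r x = s x"
  using assms(3)
proof (induction "r x" arbitrary: x rule: less_induct)
  case less
  show ?case
  proof (cases "x = \<bottom>")
    case True
    then show ?thesis using r s by (simp add: rank_function_def)
  next
    case False
    then have "\<bottom> \<sqsubset> x" using less.prems by (auto simp: lless_eq)
    then obtain z where z: "z \<in> carrier L" "covers L z x"
      using lower_cover less.prems by blast
    then have "r x = Suc (r z)" "s x = Suc (s z)"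
      using r s less.prems by (auto simp: rank_function_def)
    then show ?thesis using less.hyps[of z] z by simp
  qed
qed

lemma poset_rank_eq:
  assumes "rank_function L r" "x \<in> carrier L"
  shows "poset_rank L x = r x"
  unfolding poset_rank_def
  by (rule someI2[of _ r]) (use assms rank_function_unique in auto)

lemma least_eq_bottom: "\<lbrakk>x \<in> carrier L; x \<sqsubseteq> \<bottom>\<rbrakk> \<Longrightarrow> x = \<bottom>"
  by auto

lemma below_finite_pointed:
  assumes m: "m \<in> carrier L"
  shows "finite_pointed_poset (below L m)" and "\<bottom>\<^bsub>below L m\<^esub> = \<bottom>"
proof -
  interpret B: partial_order "below L m"
    unfolding below_def by (rule partial_order_subset) (use partial_order_axioms in auto)
  have least: "least (below L m) \<bottom> (carrier (below L m))"
    using m by (auto simp: least_def)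
  show F: "finite_pointed_poset (below L m)"
    by unfold_locales (use least finite_poset in auto)
  then interpret B: finite_pointed_poset "below L m" .
  show "\<bottom>\<^bsub>below L m\<^esub> = \<bottom>"
    using B.least_unique[OF B.bottom_least least] .
qed

text \<open>A lower interval is closed downwards, so its covers are covers of
  \<open>L\<close>.\<close>

lemma rank_function_below:
  assumes r: "rank_function L r" and m: "m \<in> carrier L"
  shows "rank_function (below L m) r"
proof -
  have "covers L x y" if "covers (below L m) x y" "x \<in> carrier (below L m)" "y \<in> carrier (below L m)" for x y
    using that m le_trans[of _ y m] unfolding covers_def lless_def by auto
  then show ?thesis
    using r by (auto simp: rank_function_def below_finite_pointed(2)[OF m])
qed

lemma poset_rank_below:
  assumes r: "rank_function L r" and m: "m \<in> carrier L" and "x \<in> carrier L" "x \<sqsubseteq> m"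
  shows "poset_rank (below L m) x = r x"
  using assms rank_function_below[OF r m]
  by (intro finite_pointed_poset.poset_rank_eq[OF below_finite_pointed(1)[OF m]]) auto

end

section \<open>Lower intervals that are geometric lattices\<close>

definition semimodular_bounds ::
    "('a, 'c) gorder_scheme \<Rightarrow> ('a \<Rightarrow> nat) \<Rightarrow> 'a \<Rightarrow> 'a \<Rightarrow> 'a \<Rightarrow> 'a \<Rightarrow> 'a \<Rightarrow> bool"
  where "semimodular_bounds L r m x z j l \<longleftrightarrow>
    j \<in> carrier L \<and> j \<sqsubseteq>\<^bsub>L\<^esub> m \<and> x \<sqsubseteq>\<^bsub>L\<^esub> j \<and> z \<sqsubseteq>\<^bsub>L\<^esub> j \<and>
    (\<forall>w\<in>carrier L. w \<sqsubseteq>\<^bsub>L\<^esub> m \<longrightarrow> x \<sqsubseteq>\<^bsub>L\<^esub> w \<longrightarrow> z \<sqsubseteq>\<^bsub>L\<^esub> w \<longrightarrow> j \<sqsubseteq>\<^bsub>L\<^esub> w) \<and>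
    l \<in> carrier L \<and> l \<sqsubseteq>\<^bsub>L\<^esub> x \<and> l \<sqsubseteq>\<^bsub>L\<^esub> z \<and>
    (\<forall>w\<in>carrier L. w \<sqsubseteq>\<^bsub>L\<^esub> x \<longrightarrow> w \<sqsubseteq>\<^bsub>L\<^esub> z \<longrightarrow> w \<sqsubseteq>\<^bsub>L\<^esub> l) \<and>
    r j + r l \<le> r x + r z"

text \<open>The content of G1 in the order of \<open>L\<close> itself, free of the joins chosen
  inside an updated record. Atomisticity appears as an order test by rank-one elements. The rank is
  a parameter because for flats it arrives as \<rho> composed with an isomorphism.\<close>

definition geometric_interval :: "('a, 'c) gorder_scheme \<Rightarrow> ('a \<Rightarrow> nat) \<Rightarrow> 'a \<Rightarrow> bool"
  where "geometric_interval L r m \<longleftrightarrow>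
    (\<forall>x\<in>carrier L. \<forall>z\<in>carrier L. x \<sqsubseteq>\<^bsub>L\<^esub> m \<longrightarrow> z \<sqsubseteq>\<^bsub>L\<^esub> m \<longrightarrow>
      ((\<forall>a\<in>carrier L. r a = 1 \<longrightarrow> a \<sqsubseteq>\<^bsub>L\<^esub> x \<longrightarrow> a \<sqsubseteq>\<^bsub>L\<^esub> z) \<longrightarrow> x \<sqsubseteq>\<^bsub>L\<^esub> z) \<and>
      (\<exists>j l. semimodular_bounds L r m x z j l))"

context finite_pointed_poset
begin

text \<open>Atomisticity comes from the order test: an upper bound of the atoms under
  \<open>x\<close> lies above \<open>x\<close>, so \<open>x\<close> is their least upper
  bound.\<close>

lemma geometric_lattice_below:
  assumes r: "rank_function L r" and m: "m \<in> carrier L" and g: "geometric_interval L r m"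
  shows "geometric_lattice (below L m)"
proof -
  let ?B = "below L m"
  interpret B: finite_pointed_poset ?B by (rule below_finite_pointed(1)[OF m])
  have rk: "poset_rank ?B x = r x" if "x \<in> carrier L" "x \<sqsubseteq> m" for x
    using poset_rank_below[OF r m that] .
  have two: "\<exists>j l. least ?B j (Upper ?B {x, z}) \<and> greatest ?B l (Lower ?B {x, z}) \<and> r j + r l \<le> r x + r z"
    if x: "x \<in> carrier ?B" and z: "z \<in> carrier ?B" for x z
  proof -
    obtain j l where jl: "semimodular_bounds L r m x z j l"
      using g x z unfolding geometric_interval_def below_simps mem_Collect_eq by blast
    then have "l \<in> carrier L" "l \<sqsubseteq> x" by (simp_all add: semimodular_bounds_def)
    then have "l \<sqsubseteq> m" using x m le_trans[of l x m] by simp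
    have "least ?B j (Upper ?B {x, z})"
      using jl x z by (auto simp: semimodular_bounds_def least_def Upper_def)
    moreover have "greatest ?B l (Lower ?B {x, z})"
      using jl x z \<open>l \<sqsubseteq> m\<close> by (auto simp: semimodular_bounds_def greatest_def Lower_def)
    moreover have "r j + r l \<le> r x + r z" using jl by (simp add: semimodular_bounds_def)
    ultimately show ?thesis by blast
  qed
  interpret B: lattice ?B
    by unfold_locales (use two in blast)+
  show ?thesis
  proof
    show "\<exists>r. rank_function ?B r" using rank_function_below[OF r m] by blast
    show "finite (carrier ?B)" by (rule B.finite_poset)
  next
    fix x assume x: "x \<in> carrier ?B"
    let ?A = "{a \<in> atoms ?B. a \<sqsubseteq> x}"
    have "least ?B x (Upper ?B ?A)"
      unfolding least_def
    proof (intro conjI ballI)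
      fix w assume w: "w \<in> Upper ?B ?A"
      then have w': "w \<in> carrier L" "w \<sqsubseteq> m" by (auto simp: Upper_def)
      have "a \<sqsubseteq> w" if a: "a \<in> carrier L" "r a = 1" "a \<sqsubseteq> x" for a
      proof -
        have "a \<sqsubseteq> m" using a x m by (auto intro: le_trans)
        then have "a \<in> ?A" using a rk by (simp add: atoms_def)
        then show ?thesis using w unfolding Upper_def using \<open>a \<sqsubseteq> m\<close> a by auto
      qed
      then have "x \<sqsubseteq> w" using g x w' unfolding geometric_interval_def by simp
      then show "x \<sqsubseteq>\<^bsub>?B\<^esub> w" by simp
    qed (use x in \<open>auto simp: Upper_def\<close>)
    then have "x = \<Squnion>\<^bsub>?B\<^esub> ?A"
      unfolding sup_def by (metis B.least_unique someI_ex)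
    then show "\<exists>A\<subseteq>atoms ?B. x = \<Squnion>\<^bsub>?B\<^esub> A" by (intro exI[of _ ?A]) auto
  next
    fix x z assume x: "x \<in> carrier ?B" and z: "z \<in> carrier ?B"
    obtain j l where j: "least ?B j (Upper ?B {x, z})" and l: "greatest ?B l (Lower ?B {x, z})"
      and le: "r j + r l \<le> r x + r z"
      using two[OF x z] by blast
    have "x \<squnion>\<^bsub>?B\<^esub> z = j" "x \<sqinter>\<^bsub>?B\<^esub> z = l"
      unfolding join_def meet_def sup_def inf_def
      using j l B.least_unique B.greatest_unique by (metis someI_ex)+
    moreover have "j \<in> carrier ?B" "l \<in> carrier ?B"
      using j l least_closed greatest_closed by blast+
    ultimately show "poset_rank ?B (x \<squnion>\<^bsub>?B\<^esub> z) + poset_rank ?B (x \<sqinter>\<^bsub>?B\<^esub> z) \<le> poset_rank ?B x + poset_rank ?B z"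
      using le rk x z by simp
  qed
qed

text \<open>G1 speaks only of maximal elements; this carries it to every \<open>m\<close> under one.
  A join formed under \<open>M\<close> of two elements under \<open>m\<close> stays under
  \<open>m\<close>, since \<open>m\<close> is one of their upper bounds.\<close>

lemma geometric_intervalI:
  assumes r: "rank_function L r" and M: "M \<in> carrier L" and g: "geometric_lattice (below L M)"
    and m: "m \<in> carrier L" "m \<sqsubseteq> M"
  shows "geometric_interval L r m"
proof -
  let ?B = "below L M"
  interpret B: geometric_lattice ?B by fact
  have rk: "poset_rank ?B x = r x" if "x \<in> carrier L" "x \<sqsubseteq> M" for x
    using poset_rank_below[OF r M that] .
  have tr: "x \<sqsubseteq> M" if "x \<in> carrier L" "x \<sqsubseteq> m" for x
    using that m M by (meson le_trans)
  show ?thesis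
    unfolding geometric_interval_def
  proof (intro ballI impI conjI)
    fix x z assume x: "x \<in> carrier L" "x \<sqsubseteq> m" and z: "z \<in> carrier L" "z \<sqsubseteq> m"
      and at: "\<forall>a\<in>carrier L. r a = 1 \<longrightarrow> a \<sqsubseteq> x \<longrightarrow> a \<sqsubseteq> z"
    have xB: "x \<in> carrier ?B" and zB: "z \<in> carrier ?B" using x z tr by auto
    obtain A where A: "A \<subseteq> atoms ?B" "x = \<Squnion>\<^bsub>?B\<^esub> A" using B.atomistic[OF xB] by blast
    have "A \<subseteq> carrier ?B" using A by (auto simp: atoms_def)
    moreover have "finite A" using B.finite_lattice calculation finite_subset by blast
    ultimately have "least ?B x (Upper ?B A)"
    proof (cases "A = {}")
      case True
      then have "least ?B \<bottom> (Upper ?B A)"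
        using M by (auto simp: least_def)
      then show ?thesis using A unfolding sup_def by (metis someI)
    qed (use A B.finite_sup_least in auto)
    moreover have "z \<in> Upper ?B A"
    proof (rule Upper_memI)
      fix a assume "a \<in> A"
      then have a: "a \<in> carrier L" "a \<sqsubseteq> M" "poset_rank ?B a = 1" "a \<sqsubseteq>\<^bsub>?B\<^esub> x"
        using A(1) \<open>A \<subseteq> carrier ?B\<close> Upper_memD[OF least_mem[OF \<open>least ?B x (Upper ?B A)\<close>]]
        by (auto simp: atoms_def)
      then show "a \<sqsubseteq>\<^bsub>?B\<^esub> z" using at rk by simp
    qed (rule zB)
    ultimately have "x \<sqsubseteq>\<^bsub>?B\<^esub> z" by (rule least_le)
    then show "x \<sqsubseteq> z" by simp
  next
    fix x z assume x: "x \<in> carrier L" "x \<sqsubseteq> m" and z: "z \<in> carrier L" "z \<sqsubseteq> m"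
    have xB: "x \<in> carrier ?B" and zB: "z \<in> carrier ?B" using x z tr by auto
    let ?j = "x \<squnion>\<^bsub>?B\<^esub> z" and ?l = "x \<sqinter>\<^bsub>?B\<^esub> z"
    have jc: "?j \<in> carrier ?B" and lc: "?l \<in> carrier ?B"
      using B.join_closed[OF xB zB] B.meet_closed[OF xB zB] by simp_all
    have jl: "x \<sqsubseteq> ?j" "z \<sqsubseteq> ?j" "?l \<sqsubseteq> x" "?l \<sqsubseteq> z"
      using B.join_left[OF xB zB] B.join_right[OF xB zB] B.meet_left[OF xB zB] B.meet_right[OF xB zB] by simp_all
    have ub: "?j \<sqsubseteq> w" if "w \<in> carrier L" "w \<sqsubseteq> m" "x \<sqsubseteq> w" "z \<sqsubseteq> w" for w
      using B.join_le[of x w z] that xB zB tr by simp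
    have lb: "w \<sqsubseteq> ?l" if "w \<in> carrier L" "w \<sqsubseteq> x" "w \<sqsubseteq> z" for w
      using B.meet_le[of w x z] that xB zB M le_trans[of w x M] by simp
    have "semimodular_bounds L r m x z ?j ?l"
      unfolding semimodular_bounds_def
      using jc lc jl ub lb ub[OF m(1)] x z m(1) B.semimodular[OF xB zB] rk tr by auto
    then show "\<exists>j l. semimodular_bounds L r m x z j l" by blast
  qed
qed

end

section \<open>Posets labelled by a Boolean structure\<close>

text \<open>
  The axioms of a labelled poset characterize simplicial posets without mentioning atoms or ranks;
  the canonical label of an element is its set of atoms.
\<close>

locale labelled_poset = finite_pointed_poset L for L (structure) +
  fixes \<alpha> :: "'a \<Rightarrow> 'x set"
  assumes finite_label: "x \<in> carrier L \<Longrightarrow> finite (\<alpha> x)"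
    and label_mono: "\<lbrakk>x \<in> carrier L; y \<in> carrier L; x \<sqsubseteq> y\<rbrakk> \<Longrightarrow> \<alpha> x \<subseteq> \<alpha> y"
    and label_reflect: "\<lbrakk>x \<in> carrier L; y \<in> carrier L; u \<in> carrier L; x \<sqsubseteq> u; y \<sqsubseteq> u; \<alpha> x \<subseteq> \<alpha> y\<rbrakk> \<Longrightarrow> x \<sqsubseteq> y"
    and label_restrict: "\<lbrakk>x \<in> carrier L; B \<subseteq> \<alpha> x\<rbrakk> \<Longrightarrow> \<exists>y\<in>carrier L. y \<sqsubseteq> x \<and> \<alpha> y = B"
begin

lemma label_inj:
  "\<lbrakk>x \<in> carrier L; y \<in> carrier L; u \<in> carrier L; x \<sqsubseteq> u; y \<sqsubseteq> u; \<alpha> x = \<alpha> y\<rbrakk> \<Longrightarrow> x = y"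
  using label_reflect[of x y u] label_reflect[of y x u] by auto

lemma label_bottom: "\<alpha> \<bottom> = {}"
  using label_restrict[of \<bottom> "{}"] least_eq_bottom by auto

text \<open>A cover adds exactly one label: restricting \<open>y\<close> to
  \<open>insert b (\<alpha> x)\<close> gives an element strictly above \<open>x\<close>, hence
  \<open>y\<close> itself.\<close>

lemma rank_function_label: "rank_function L (\<lambda>x. card (\<alpha> x))"
  unfolding rank_function_def
proof (intro conjI ballI impI)
  fix x y assume x: "x \<in> carrier L" and y: "y \<in> carrier L" and c: "covers L x y"
  have xy: "x \<sqsubseteq> y" "x \<noteq> y" using c by (auto simp: covers_def lless_eq)
  then have "\<alpha> x \<subset> \<alpha> y" using label_mono label_inj[of x y y] x y by auto
  then obtain b where b: "b \<in> \<alpha> y" "b \<notin> \<alpha> x" by blast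
  obtain z where z: "z \<in> carrier L" "z \<sqsubseteq> y" "\<alpha> z = insert b (\<alpha> x)"
    using label_restrict[OF y, of "insert b (\<alpha> x)"] b \<open>\<alpha> x \<subset> \<alpha> y\<close> by auto
  have "x \<sqsubseteq> z" "x \<noteq> z" using label_reflect[OF x z(1) y xy(1) z(2)] z(3) b by auto
  then have "z = y" using c z by (auto simp: covers_def lless_eq)
  then show "card (\<alpha> y) = Suc (card (\<alpha> x))" using z b finite_label[OF x] by simp
qed (simp_all add: label_bottom label_mono finite_label card_mono)

lemma poset_rank_label: "x \<in> carrier L \<Longrightarrow> poset_rank L x = card (\<alpha> x)"
  using poset_rank_eq[OF rank_function_label] .

lemma atoms_label: "atoms L = {a \<in> carrier L. \<exists>b. \<alpha> a = {b}}"
  using poset_rank_label by (auto simp: atoms_def card_1_singleton_iff)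

lemma label_eq_atoms:
  assumes "x \<in> carrier L"
  shows "\<alpha> x = (\<Union>a\<in>{a \<in> atoms L. a \<sqsubseteq> x}. \<alpha> a)"
proof
  show "\<alpha> x \<subseteq> (\<Union>a\<in>{a \<in> atoms L. a \<sqsubseteq> x}. \<alpha> a)"
  proof
    fix b assume "b \<in> \<alpha> x"
    then obtain a where "a \<in> carrier L" "a \<sqsubseteq> x" "\<alpha> a = {b}"
      using label_restrict[OF assms, of "{b}"] by auto
    then show "b \<in> (\<Union>a\<in>{a \<in> atoms L. a \<sqsubseteq> x}. \<alpha> a)" by (auto simp: atoms_label)
  qed
qed (use label_mono assms in \<open>auto simp: atoms_label\<close>)

text \<open>By \<open>label_eq_atoms\<close>, inclusion of atom sets gives inclusion of labels. A
  set of atoms under \<open>x\<close> is attained at the restriction of \<open>x\<close> to the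
  union of their labels.\<close>

lemma simplicial: "simplicial_poset L"
proof
  show "\<exists>r. rank_function L r" using rank_function_label by blast
  show "finite (carrier L)" by (rule finite_poset)
next
  fix x assume x: "x \<in> carrier L"
  let ?at = "\<lambda>y. {a \<in> atoms L. a \<sqsubseteq> y}"
  let ?P = "\<lparr>carrier = Pow (?at x), eq = (=), le = (\<subseteq>)\<rparr>"
  interpret B: finite_pointed_poset "below L x" by (rule below_finite_pointed(1)[OF x])
  have at_c: "?at y \<subseteq> carrier L" for y by (auto simp: atoms_def)
  have refl: "y \<sqsubseteq> z" if "y \<in> carrier L" "z \<in> carrier L" "y \<sqsubseteq> x" "z \<sqsubseteq> x" "?at y \<subseteq> ?at z" for y z
    using label_reflect[of y z x] label_eq_atoms[of y] label_eq_atoms[of z] that x by blast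
  have mono: "?at y \<subseteq> ?at z" if "y \<in> carrier L" "z \<in> carrier L" "y \<sqsubseteq> z" for y z
    using that at_c[of y] le_trans[of _ y z] by blast
  have "bij_betw ?at (carrier (below L x)) (Pow (?at x))"
    unfolding bij_betw_def
  proof
    show "inj_on ?at (carrier (below L x))"
      by (rule inj_onI) (use refl in auto)
    show "?at ` carrier (below L x) = Pow (?at x)"
    proof
      show "?at ` carrier (below L x) \<subseteq> Pow (?at x)" using mono[OF _ x] by force
    next
      show "Pow (?at x) \<subseteq> ?at ` carrier (below L x)"
      proof
        fix B assume B: "B \<in> Pow (?at x)"
        have "(\<Union>a\<in>B. \<alpha> a) \<subseteq> \<alpha> x" using B label_eq_atoms[OF x] by auto
        then obtain y where y: "y \<in> carrier L" "y \<sqsubseteq> x" "\<alpha> y = (\<Union>a\<in>B. \<alpha> a)"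
          using label_restrict[OF x] by blast
        have "?at y = B"
        proof
          show "B \<subseteq> ?at y"
          proof
            fix a assume a: "a \<in> B"
            then have "a \<in> ?at x" using B by blast
            then show "a \<in> ?at y" using label_reflect[of a y x] y a x by (auto simp: atoms_label)
          qed
        next
          show "?at y \<subseteq> B"
          proof
            fix a assume a: "a \<in> ?at y"
            then obtain b where b: "\<alpha> a = {b}" "a \<in> carrier L" by (auto simp: atoms_label)
            then have "b \<in> \<alpha> y" using label_mono a y by blast
            then obtain a' where a': "a' \<in> B" "b \<in> \<alpha> a'" using y by blast
            then have "\<alpha> a' = {b}" "a' \<in> carrier L" "a' \<sqsubseteq> x" using B by (auto simp: atoms_label)
            moreover have "a \<sqsubseteq> x" using a y x b by (auto intro: le_trans)
            \<comment> \<open>Different atoms may carry the same label; these two agree because both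
              lie under \<open>x\<close>.\<close>
            ultimately have "a = a'" using label_inj[of a a' x] b x by simp
            then show "a \<in> B" using a' by simp
          qed
        qed
        then show "B \<in> ?at ` carrier (below L x)" using y by auto
      qed
    qed
  qed
  moreover have "weak_partial_order ?P"
    by unfold_locales auto
  moreover have "\<forall>y\<in>carrier (below L x). \<forall>z\<in>carrier (below L x). (?at y \<subseteq> ?at z) \<longleftrightarrow> y \<sqsubseteq> z"
    using refl mono by (metis (no_types, lifting) below_simps(1) mem_Collect_eq)
  ultimately show "poset_isomorphic (below L x) ?P"
    unfolding poset_isomorphic_def poset_iso_def order_emb_def
    using B.weak_partial_order_axioms by (intro exI[of _ ?at]) auto
qed

text \<open>Restricting an upper bound to \<open>\<alpha> x \<union> \<alpha> y\<close> gives a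
  smaller upper bound. Minimality thus fixes the label of a join, though not the join
  itself.\<close>

lemma joins_label:
  assumes "x \<in> carrier L" "y \<in> carrier L"
  shows "u \<in> joins L {x, y} \<longleftrightarrow> u \<in> carrier L \<and> x \<sqsubseteq> u \<and> y \<sqsubseteq> u \<and> \<alpha> u = \<alpha> x \<union> \<alpha> y"
proof
  assume u: "u \<in> joins L {x, y}"
  then have u': "u \<in> carrier L" "x \<sqsubseteq> u" "y \<sqsubseteq> u"
    using assms by (auto simp: joins_def minimals_def Upper_def)
  then have "\<alpha> x \<union> \<alpha> y \<subseteq> \<alpha> u" using label_mono assms by blast
  then obtain v where v: "v \<in> carrier L" "v \<sqsubseteq> u" "\<alpha> v = \<alpha> x \<union> \<alpha> y"
    using label_restrict u' by metis
  then have "x \<sqsubseteq> v" "y \<sqsubseteq> v" using label_reflect[of _ v u] assms u' by auto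
  then have "v = u" using u v by (auto simp: joins_def minimals_def Upper_def)
  with v u' show "u \<in> carrier L \<and> x \<sqsubseteq> u \<and> y \<sqsubseteq> u \<and> \<alpha> u = \<alpha> x \<union> \<alpha> y" by simp
next
  assume u: "u \<in> carrier L \<and> x \<sqsubseteq> u \<and> y \<sqsubseteq> u \<and> \<alpha> u = \<alpha> x \<union> \<alpha> y"
  have "v = u" if v: "v \<in> carrier L" "v \<sqsubseteq> u" "x \<sqsubseteq> v" "y \<sqsubseteq> v" for v
  proof -
    have "\<alpha> v = \<alpha> u" using label_mono[of v u] label_mono[of x v] label_mono[of y v] u v assms by auto
    then show ?thesis using label_inj[of v u u] u v by simp
  qed
  then show "u \<in> joins L {x, y}" using u assms by (auto simp: joins_def minimals_def Upper_def)
qed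

lemma meets_label:
  assumes "x \<in> carrier L" "y \<in> carrier L" "m \<in> carrier L" "m \<sqsubseteq> x" "m \<sqsubseteq> y" "\<alpha> m = \<alpha> x \<inter> \<alpha> y"
  shows "meets L {x, y} = {m}"
proof -
  have low: "v \<sqsubseteq> m" if "v \<in> carrier L" "v \<sqsubseteq> x" "v \<sqsubseteq> y" for v
    using label_reflect[of v m x] label_mono[of v x] label_mono[of v y] that assms by auto
  show ?thesis
    using low assms by (auto simp: meets_def maximals_def Lower_def)
qed

lemma bounded_joins:
  assumes "x \<in> carrier L" "y \<in> carrier L" "w \<in> carrier L" "x \<sqsubseteq> w" "y \<sqsubseteq> w"
  shows "\<exists>u\<in>joins L {x, y}. u \<sqsubseteq> w"
  using joins_below[of w "{x, y}"] assms by (auto simp: Upper_def)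

text \<open>This justifies \<open>the_elem\<close> in M3. Under \<open>w\<close>, the restriction of
  \<open>x\<close> to the common labels is also below \<open>y\<close>, and it dominates every
  common lower bound.\<close>

lemma bounded_meets:
  assumes "x \<in> carrier L" "y \<in> carrier L" "w \<in> carrier L" "x \<sqsubseteq> w" "y \<sqsubseteq> w"
  shows "\<exists>m. meets L {x, y} = {m} \<and> m \<in> carrier L \<and> m \<sqsubseteq> x \<and> m \<sqsubseteq> y \<and> \<alpha> m = \<alpha> x \<inter> \<alpha> y \<and>
    (\<forall>v\<in>carrier L. v \<sqsubseteq> x \<longrightarrow> v \<sqsubseteq> y \<longrightarrow> v \<sqsubseteq> m)"
proof -
  obtain m where m: "m \<in> carrier L" "m \<sqsubseteq> x" "\<alpha> m = \<alpha> x \<inter> \<alpha> y"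
    using label_restrict[OF assms(1), of "\<alpha> x \<inter> \<alpha> y"] by blast
  have "m \<sqsubseteq> y" using label_reflect[of m y w] m assms le_trans[of m x w] by simp
  moreover have "v \<sqsubseteq> m" if "v \<in> carrier L" "v \<sqsubseteq> x" "v \<sqsubseteq> y" for v
    using label_reflect[of v m x] label_mono[of v x] label_mono[of v y] that assms m by auto
  ultimately show ?thesis using meets_label m assms by auto
qed

end

section \<open>Simplicial posets\<close>

sublocale simplicial_poset \<subseteq> finite_pointed_poset S
  by unfold_locales (rule finite_carrier)

context ranked_poset
begin

lemma rank_function_poset_rank: "rank_function L (poset_rank L)"
  unfolding poset_rank_def using ranked by (rule someI_ex)

lemma poset_rank_bottom: "poset_rank L \<bottom> = 0"
  using rank_function_poset_rank by (simp add: rank_function_def)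

lemma poset_rank_mono:
  "\<lbrakk>x \<in> carrier L; y \<in> carrier L; x \<sqsubseteq> y\<rbrakk> \<Longrightarrow> poset_rank L x \<le> poset_rank L y"
  using rank_function_poset_rank by (auto simp: rank_function_def)

lemma poset_rank_cover:
  "\<lbrakk>x \<in> carrier L; y \<in> carrier L; covers L x y\<rbrakk> \<Longrightarrow> poset_rank L y = Suc (poset_rank L x)"
  using rank_function_poset_rank by (auto simp: rank_function_def)

end

lemma atoms_closed: "a \<in> atoms L \<Longrightarrow> a \<in> carrier L"
  by (simp add: atoms_def)

context simplicial_poset
begin

text \<open>Turns being an atom into a pure order property, which an order isomorphism can
  detect.\<close>

lemma atoms_eq_covers: "a \<in> atoms S \<longleftrightarrow> a \<in> carrier S \<and> covers S \<bottom> a"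
proof
  assume a: "a \<in> atoms S"
  then have ac: "a \<in> carrier S" and r: "poset_rank S a = 1" by (auto simp: atoms_def)
  then have "\<bottom> \<sqsubset> a" using poset_rank_bottom by (auto simp: lless_eq)
  moreover have "\<not> (\<bottom> \<sqsubset> z \<and> z \<sqsubset> a)" if z: "z \<in> carrier S" for z
    using rank_function_strict[OF rank_function_poset_rank bottom_closed z]
      rank_function_strict[OF rank_function_poset_rank z ac] r by auto
  ultimately show "a \<in> carrier S \<and> covers S \<bottom> a" using ac by (auto simp: covers_def)
next
  assume "a \<in> carrier S \<and> covers S \<bottom> a"
  then show "a \<in> atoms S"
    using poset_rank_cover[of \<bottom> a] poset_rank_bottom by (simp add: atoms_def)
qed

definition at :: "'a \<Rightarrow> 'a set"
  where "at x = {a \<in> atoms S. a \<sqsubseteq> x}"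

text \<open>
  The given isomorphism of a lower interval with a Boolean lattice need not send \<open>y\<close> to its set of
  atoms, but it sends atoms to singletons and hence differs from that map by a permutation.
\<close>

lemma boolean_interval:
  assumes x: "x \<in> carrier S"
  obtains f where "bij_betw f {y \<in> carrier S. y \<sqsubseteq> x} (Pow (at x))"
    and "\<And>y z. \<lbrakk>y \<in> carrier S; y \<sqsubseteq> x; z \<in> carrier S; z \<sqsubseteq> x\<rbrakk> \<Longrightarrow> f y \<subseteq> f z \<longleftrightarrow> y \<sqsubseteq> z"
    and "\<And>y. \<lbrakk>y \<in> carrier S; y \<sqsubseteq> x\<rbrakk> \<Longrightarrow> y \<in> atoms S \<longleftrightarrow> (\<exists>b. f y = {b})"
proof -
  let ?C = "{y \<in> carrier S. y \<sqsubseteq> x}"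
  obtain f where f: "bij_betw f ?C (Pow (at x))"
    and le: "\<And>y z. \<lbrakk>y \<in> ?C; z \<in> ?C\<rbrakk> \<Longrightarrow> f y \<subseteq> f z \<longleftrightarrow> y \<sqsubseteq> z"
    using boolean_intervals[OF x]
    unfolding poset_isomorphic_def poset_iso_def order_emb_def at_def by auto
  have surj: "\<exists>y\<in>?C. f y = D" if "D \<subseteq> at x" for D
    using f that unfolding bij_betw_def by (metis (no_types, lifting) PowI imageE)
  have inj: "y = z" if "y \<in> ?C" "z \<in> ?C" "f y = f z" for y z
    using f that unfolding bij_betw_def inj_on_def by blast
  have range: "f y \<subseteq> at x" if "y \<in> ?C" for y
    using bij_betw_apply[OF f that] by simp
  have bot: "\<bottom> \<in> ?C" using x by simp
  have f_bot: "f \<bottom> = {}"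
  proof -
    obtain y where "y \<in> ?C" "f y = {}" using surj[of "{}"] by blast
    then show ?thesis using le[OF bot, of y] by auto
  qed
  have "y \<in> atoms S \<longleftrightarrow> (\<exists>b. f y = {b})" if y: "y \<in> ?C" for y
  proof
    assume "y \<in> atoms S"
    then have c: "covers S \<bottom> y" by (simp add: atoms_eq_covers)
    then have "y \<noteq> \<bottom>" by (auto simp: covers_def lless_eq)
    then have "f y \<noteq> {}" using inj[OF y bot] f_bot by auto
    then obtain b where b: "b \<in> f y" by blast
    then obtain z where z: "z \<in> ?C" "f z = {b}" using surj[of "{b}"] range[OF y] by blast
    then have "z \<sqsubseteq> y" "z \<noteq> \<bottom>" using le[OF z(1) y] b f_bot by auto
    then have "z = y" using c z by (auto simp: covers_def lless_eq)
    then show "\<exists>b. f y = {b}" using z by blast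
  next
    assume "\<exists>b. f y = {b}"
    then obtain b where b: "f y = {b}" by blast
    then have "\<bottom> \<sqsubset> y" using f_bot y by (auto simp: lless_eq)
    moreover have "\<not> (\<bottom> \<sqsubset> z \<and> z \<sqsubset> y)" if z: "z \<in> carrier S" for z
    proof
      assume *: "\<bottom> \<sqsubset> z \<and> z \<sqsubset> y"
      then have zC: "z \<in> ?C" using z y x le_trans[of z y x] by (auto simp: lless_eq)
      then have "f z \<subseteq> {b}" "f z \<noteq> {b}" "f z \<noteq> {}"
        using * b le[OF zC y] inj[OF zC y] inj[OF zC bot] f_bot by (auto simp: lless_eq)
      then show False by blast
    qed
    ultimately show "y \<in> atoms S" using y by (auto simp: atoms_eq_covers covers_def)
  qed
  with f le show ?thesis by (intro that[of f]) auto
qed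

text \<open>In the Boolean picture \<open>f\<close>, atoms are singletons, so \<open>f x\<close> is
  the union of the images of the atoms under \<open>x\<close>. Inclusion of atom sets then is
  inclusion of images, and a set \<open>B\<close> of atoms comes from the preimage of the union of
  its singletons.\<close>

lemma labelled_at: "labelled_poset S at"
proof
  fix x assume "x \<in> carrier S"
  have "at x \<subseteq> carrier S" by (auto simp: at_def atoms_def)
  then show "finite (at x)" using finite_carrier finite_subset by blast
next
  fix x y assume "x \<in> carrier S" "y \<in> carrier S" "x \<sqsubseteq> y"
  then show "at x \<subseteq> at y" using le_trans[of _ x y] by (auto simp: at_def atoms_def)
next
  fix x y u assume x: "x \<in> carrier S" "x \<sqsubseteq> u" and y: "y \<in> carrier S" "y \<sqsubseteq> u"
    and u: "u \<in> carrier S" and sub: "at x \<subseteq> at y"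
  obtain f where f: "bij_betw f {y \<in> carrier S. y \<sqsubseteq> u} (Pow (at u))"
    and le: "\<And>y z. \<lbrakk>y \<in> carrier S; y \<sqsubseteq> u; z \<in> carrier S; z \<sqsubseteq> u\<rbrakk> \<Longrightarrow> f y \<subseteq> f z \<longleftrightarrow> y \<sqsubseteq> z"
    and at: "\<And>y. \<lbrakk>y \<in> carrier S; y \<sqsubseteq> u\<rbrakk> \<Longrightarrow> y \<in> atoms S \<longleftrightarrow> (\<exists>b. f y = {b})"
    by (rule boolean_interval[OF u]) (rule that)
  have "f x \<subseteq> f y"
  proof
    fix b assume b: "b \<in> f x"
    have "f x \<in> Pow (at u)" using bij_betw_apply[OF f, of x] x by simp
    then have "{b} \<in> f ` {y \<in> carrier S. y \<sqsubseteq> u}" using f b unfolding bij_betw_def by blast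
    then obtain t where t: "t \<in> carrier S" "t \<sqsubseteq> u" "f t = {b}" by auto
    then have "t \<in> at x" using at le[of t x] b x by (auto simp: at_def)
    then show "b \<in> f y" using sub le[of t y] t y by (auto simp: at_def)
  qed
  then show "x \<sqsubseteq> y" using le x y by blast
next
  fix x B assume x: "x \<in> carrier S" and B: "B \<subseteq> at x"
  obtain f where f: "bij_betw f {y \<in> carrier S. y \<sqsubseteq> x} (Pow (at x))"
    and le: "\<And>y z. \<lbrakk>y \<in> carrier S; y \<sqsubseteq> x; z \<in> carrier S; z \<sqsubseteq> x\<rbrakk> \<Longrightarrow> f y \<subseteq> f z \<longleftrightarrow> y \<sqsubseteq> z"
    and at: "\<And>y. \<lbrakk>y \<in> carrier S; y \<sqsubseteq> x\<rbrakk> \<Longrightarrow> y \<in> atoms S \<longleftrightarrow> (\<exists>b. f y = {b})"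
    by (rule boolean_interval[OF x]) (rule that)
  have Bc: "a \<in> carrier S" "a \<sqsubseteq> x" "a \<in> atoms S" if "a \<in> B" for a
    using that B by (auto simp: at_def atoms_def)
  have "f a \<subseteq> at x" if "a \<in> B" for a
    using bij_betw_apply[OF f, of a] Bc[OF that] by simp
  then have "(\<Union>a\<in>B. f a) \<in> Pow (at x)" by blast
  then have "(\<Union>a\<in>B. f a) \<in> f ` {y \<in> carrier S. y \<sqsubseteq> x}"
    using f by (simp add: bij_betw_def)
  then obtain y where y: "y \<in> carrier S" "y \<sqsubseteq> x" "f y = (\<Union>a\<in>B. f a)" by auto
  have "at y = B"
  proof (intro equalityI subsetI)
    fix a assume a: "a \<in> B"
    then have "f a \<subseteq> f y" using y by blast
    then show "a \<in> at y" using le[of a y] Bc[OF a] y by (simp add: at_def)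
  next
    fix a assume a: "a \<in> at y"
    then have ac: "a \<in> carrier S" "a \<in> atoms S" "a \<sqsubseteq> y" by (auto simp: at_def atoms_def)
    then have ax: "a \<sqsubseteq> x" using y x le_trans[of a y x] by simp
    then obtain b where b: "f a = {b}" using at ac by blast
    then have "b \<in> f y" using le[of a y] ac ax y by simp
    then obtain a' where a': "a' \<in> B" "b \<in> f a'" using y by auto
    then have "f a' = {b}" using at[of a'] Bc[OF a'(1)] by auto
    then have "a = a'" using le[of a a'] le[of a' a] b ac ax Bc[OF a'(1)] by auto
    then show "a \<in> B" using a' by simp
  qed
  then show "\<exists>y\<in>carrier S. y \<sqsubseteq> x \<and> at y = B" using y by blast
qed

end

sublocale simplicial_poset \<subseteq> labelled_poset S at
  by (rule labelled_at)

section \<open>Closures and flats\<close>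

context matroid_scheme
begin

lemma rho_bottom: "\<rho> \<bottom> = 0"
  using M1[OF bottom_closed] poset_rank_bottom by simp

lemma rho_atom: "a \<in> atoms S \<Longrightarrow> \<rho> a \<le> 1"
  using M1[of a] by (simp add: atoms_def)

text \<open>M3 with any common lower bound in place of the meet, which removes
  \<open>the_elem\<close> from later arguments.\<close>

lemma submodular:
  assumes "x \<in> carrier S" "y \<in> carrier S" "u \<in> joins S {x, y}"
    and "v \<in> carrier S" "v \<sqsubseteq> x" "v \<sqsubseteq> y"
  shows "\<rho> u + \<rho> v \<le> \<rho> x + \<rho> y"
proof -
  have u: "u \<in> carrier S" "x \<sqsubseteq> u" "y \<sqsubseteq> u" using joins_label assms by auto
  obtain m where m: "meets S {x, y} = {m}" "m \<in> carrier S" "v \<sqsubseteq> m"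
    using bounded_meets[OF assms(1,2) u] assms by blast
  then have "\<rho> u + \<rho> m \<le> \<rho> x + \<rho> y" using M3[OF assms(1-3)] by simp
  moreover have "\<rho> v \<le> \<rho> m" using M2 m assms by blast
  ultimately show ?thesis by simp
qed

text \<open>The engine for closures: an element \<open>c\<close> adding no rank over
  \<open>x\<close> can be joined to every \<open>y\<close> above \<open>x\<close> without raising
  the rank of \<open>y\<close>. M4 supplies the join and M3 bounds its rank.\<close>

lemma extend_over:
  assumes x: "x \<in> carrier S" and c: "c \<in> carrier S" "x \<sqsubseteq> c" "\<rho> c = \<rho> x"
    and y: "y \<in> carrier S" "x \<sqsubseteq> y"
  shows "\<exists>u\<in>carrier S. c \<sqsubseteq> u \<and> y \<sqsubseteq> u \<and> \<rho> u = \<rho> y"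
proof -
  \<comment> \<open>No common upper bound of \<open>c\<close> and \<open>y\<close> is known yet, so
    the meet may have several members. One above \<open>x\<close> is selected; monotonicity squeezes
    its rank to that of \<open>c\<close>.\<close>
  have "x \<in> Lower S {c, y}" using assms by (auto simp: Lower_def)
  then obtain l where l: "l \<in> meets S {c, y}" "x \<sqsubseteq> l"
    using maximals_above[OF Lower_closed] unfolding meets_def by blast
  then have l': "l \<in> carrier S" "l \<sqsubseteq> c" "l \<sqsubseteq> y"
    using c y by (auto simp: meets_def maximals_def Lower_def)
  have "\<rho> c = \<rho> l" using M2[OF x l'(1) l(2)] M2[OF l'(1) c(1) l'(2)] c by simp
  then obtain u where u: "u \<in> joins S {c, y}" using M4[OF c(1) y(1) l(1)] by blast
  have u': "u \<in> carrier S" "c \<sqsubseteq> u" "y \<sqsubseteq> u" using joins_label c y u by auto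
  have "\<rho> u + \<rho> x \<le> \<rho> c + \<rho> y" using submodular[OF c(1) y(1) u x c(2) y(2)] .
  then have "\<rho> u = \<rho> y" using M2[OF y(1) u'(1) u'(3)] c by simp
  with u' show ?thesis by blast
qed

end

text \<open>Closures are defined only for records without extension fields.\<close>

locale plain_matroid_scheme = matroid_scheme S \<rho> for S :: "'a gorder" (structure) and \<rho>
begin

text \<open>By \<open>extend_over\<close>, two elements above \<open>x\<close> with the rank of
  \<open>x\<close> have a common upper bound of that rank, so a maximal such element is the greatest
  one.\<close>

lemma closure_maximals:
  assumes x: "x \<in> carrier S"
  shows "\<exists>c\<in>carrier S. x \<sqsubseteq> c \<and> \<rho> c = \<rho> x \<and> closure S \<rho> x = c \<and>
    (\<forall>y\<in>carrier S. x \<sqsubseteq> y \<longrightarrow> \<rho> y = \<rho> x \<longrightarrow> y \<sqsubseteq> c)"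
proof -
  let ?G = "{y \<in> carrier S. x \<sqsubseteq> y \<and> \<rho> y = \<rho> x}"
  obtain c where c: "c \<in> maximals S ?G" using maximals_above[of ?G x] x by auto
  then have c': "c \<in> carrier S" "x \<sqsubseteq> c" "\<rho> c = \<rho> x" by (auto simp: maximals_def)
  have top: "y \<sqsubseteq> c" if y: "y \<in> ?G" for y
  proof -
    obtain u where u: "u \<in> carrier S" "c \<sqsubseteq> u" "y \<sqsubseteq> u" "\<rho> u = \<rho> y"
      using extend_over[OF x c', of y] y by blast
    then have "u \<in> ?G" using y x le_trans[of x y u] by auto
    then have "u = c" using c u by (auto simp: maximals_def)
    then show ?thesis using u by simp
  qed
  have "closure S \<rho> x = c"
    unfolding closure_def
  proof (rule the_equality)
    show "c \<in> maximals S ?G" by (rule c)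
  next
    fix z assume "z \<in> maximals S ?G"
    then show "z = c" using top[of z] c' by (auto simp: maximals_def)
  qed
  then show ?thesis using c' top by auto
qed

lemma closure_closed: "x \<in> carrier S \<Longrightarrow> closure S \<rho> x \<in> carrier S"
  and closure_above: "x \<in> carrier S \<Longrightarrow> x \<sqsubseteq> closure S \<rho> x"
  and rho_closure: "x \<in> carrier S \<Longrightarrow> \<rho> (closure S \<rho> x) = \<rho> x"
  and closure_greatest: "\<lbrakk>x \<in> carrier S; y \<in> carrier S; x \<sqsubseteq> y; \<rho> y = \<rho> x\<rbrakk> \<Longrightarrow> y \<sqsubseteq> closure S \<rho> x"
  using closure_maximals[of x] by auto

lemma closure_mono:
  assumes "x \<in> carrier S" "y \<in> carrier S" "x \<sqsubseteq> y"
  shows "closure S \<rho> x \<sqsubseteq> closure S \<rho> y"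
proof -
  note cl = closure_closed[OF assms(1)] closure_above[OF assms(1)] rho_closure[OF assms(1)]
  obtain u where u: "u \<in> carrier S" "closure S \<rho> x \<sqsubseteq> u" "y \<sqsubseteq> u" "\<rho> u = \<rho> y"
    using extend_over[OF assms(1) cl assms(2,3)] by blast
  then show ?thesis
    using closure_greatest[OF assms(2) u(1,3,4)] closure_closed[OF assms(2)] cl(1)
      le_trans[OF u(2), of "closure S \<rho> y"] by simp
qed

lemma flat_iff: "x \<in> flats S \<rho> \<longleftrightarrow> x \<in> carrier S \<and> (\<forall>y\<in>carrier S. x \<sqsubseteq> y \<longrightarrow> \<rho> y = \<rho> x \<longrightarrow> y = x)"
proof
  assume x: "x \<in> flats S \<rho>"
  then have xc: "x \<in> carrier S" "closure S \<rho> x = x" by (auto simp: flats_def)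
  show "x \<in> carrier S \<and> (\<forall>y\<in>carrier S. x \<sqsubseteq> y \<longrightarrow> \<rho> y = \<rho> x \<longrightarrow> y = x)"
    using closure_greatest[of x] xc by auto
next
  assume "x \<in> carrier S \<and> (\<forall>y\<in>carrier S. x \<sqsubseteq> y \<longrightarrow> \<rho> y = \<rho> x \<longrightarrow> y = x)"
  then show "x \<in> flats S \<rho>"
    using closure_closed closure_above rho_closure by (simp add: flats_def)
qed

lemma flat_closed: "x \<in> flats S \<rho> \<Longrightarrow> x \<in> carrier S"
  and flat_closure: "x \<in> flats S \<rho> \<Longrightarrow> closure S \<rho> x = x"
  by (auto simp: flats_def)

lemma closure_flat: "x \<in> carrier S \<Longrightarrow> closure S \<rho> x \<in> flats S \<rho>"
proof -
  assume x: "x \<in> carrier S"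
  note cl = closure_closed[OF x] closure_above[OF x] rho_closure[OF x]
  have "y = closure S \<rho> x" if y: "y \<in> carrier S" "closure S \<rho> x \<sqsubseteq> y" "\<rho> y = \<rho> (closure S \<rho> x)" for y
    using closure_greatest[OF x y(1)] y cl x le_trans[OF cl(2) y(2)] le_antisym by simp
  then show ?thesis using cl by (simp add: flat_iff)
qed

lemma closure_least:
  assumes "x \<in> carrier S" "w \<in> flats S \<rho>" "x \<sqsubseteq> w"
  shows "closure S \<rho> x \<sqsubseteq> w"
  using closure_mono[OF assms(1) flat_closed[OF assms(2)] assms(3)] flat_closure[OF assms(2)] by simp

lemma flat_strict:
  assumes "x \<in> flats S \<rho>" "y \<in> carrier S" "x \<sqsubseteq> y" "x \<noteq> y"
  shows "\<rho> x < \<rho> y"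
  using assms M2[of x y] flat_iff[of x] by (metis le_neq_implies_less)

text \<open>Loops lie under the closure of \<open>\<bottom>\<close>, which is the least
  flat.\<close>

lemma flat_above_loops:
  assumes w: "w \<in> flats S \<rho>" and a: "a \<in> carrier S" "\<rho> a = 0"
  shows "a \<sqsubseteq> w"
proof -
  have wc: "w \<in> carrier S" using w by (rule flat_closed)
  have "closure S \<rho> \<bottom> \<sqsubseteq> w" using closure_least[OF bottom_closed w] wc by simp
  moreover have "a \<sqsubseteq> closure S \<rho> \<bottom>" using closure_greatest[of \<bottom> a] a rho_bottom by simp
  ultimately show ?thesis using le_trans[of a "closure S \<rho> \<bottom>" w] a wc closure_closed[of \<bottom>] by simp
qed

text \<open>Atoms decide the order only below a common bound, which is the purpose of
  \<open>u\<close>. Loops pass the test automatically, as every flat lies above them.\<close>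

lemma below_flatI:
  assumes w: "w \<in> flats S \<rho>" and x: "x \<in> carrier S" and u: "u \<in> carrier S" "x \<sqsubseteq> u" "w \<sqsubseteq> u"
    and nl: "\<And>a. \<lbrakk>a \<in> atoms S; a \<sqsubseteq> x; \<rho> a = 1\<rbrakk> \<Longrightarrow> a \<sqsubseteq> w"
  shows "x \<sqsubseteq> w"
proof (rule label_reflect[OF x flat_closed[OF w] u])
  show "at x \<subseteq> at w"
  proof
    fix a assume a: "a \<in> at x"
    then have a': "a \<in> atoms S" "a \<sqsubseteq> x" "a \<in> carrier S" by (auto simp: at_def atoms_def)
    then have "\<rho> a = 0 \<or> \<rho> a = 1" using rho_atom[of a] by auto
    then have "a \<sqsubseteq> w" using flat_above_loops[OF w] nl a' by blast
    then show "a \<in> at w" using a' by (simp add: at_def)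
  qed
qed

text \<open>If all atoms under \<open>x\<close> were loops, \<open>x\<close> would lie under the
  closure of \<open>\<bottom>\<close> and have rank 0. The common upper bound for this comparison
  comes from \<open>extend_over\<close>.\<close>

lemma nonloop_below:
  assumes x: "x \<in> carrier S" "\<rho> x \<noteq> 0"
  shows "\<exists>a\<in>atoms S. a \<sqsubseteq> x \<and> \<rho> a = 1"
proof (rule ccontr)
  assume c: "\<not> ?thesis"
  let ?c = "closure S \<rho> \<bottom>"
  have cl: "?c \<in> carrier S" "\<rho> ?c = 0" using closure_closed rho_closure rho_bottom by auto
  obtain u where "u \<in> carrier S" "?c \<sqsubseteq> u" "x \<sqsubseteq> u"
    using extend_over[OF bottom_closed cl(1) _ _ x(1)] cl x rho_bottom by auto
  then have "x \<sqsubseteq> ?c" using below_flatI[OF closure_flat x(1)] c by blast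
  then show False using M2[OF x(1) cl(1)] cl x by simp
qed

text \<open>A rank-one flat may lie above many parallel atoms of \<open>S\<close>, and each of them
  determines it. Atoms of the poset of flats can therefore be represented by atoms of
  \<open>S\<close>.\<close>

lemma closure_nonloop:
  assumes "x \<in> flats S \<rho>" "\<rho> x = 1" "a \<in> carrier S" "a \<sqsubseteq> x" "\<rho> a = 1"
  shows "closure S \<rho> a = x"
  using closure_least[OF assms(3,1,4)] closure_flat[OF assms(3)] rho_closure[OF assms(3)]
    flat_closed[OF assms(1)] flat_iff[of "closure S \<rho> a"] assms by auto

text \<open>An atom of \<open>y\<close> outside \<open>x\<close> raises the rank by at most one, by
  submodularity over \<open>\<bottom>\<close>, and by at least one because \<open>x\<close> is a
  flat. The closure of the resulting join is \<open>z\<close>.\<close>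

lemma add_atom:
  assumes x: "x \<in> flats S \<rho>" and y: "y \<in> flats S \<rho>" "x \<sqsubseteq> y" "x \<noteq> y"
  shows "\<exists>z\<in>flats S \<rho>. x \<sqsubseteq> z \<and> z \<sqsubseteq> y \<and> \<rho> z = Suc (\<rho> x)"
proof -
  have xc: "x \<in> carrier S" and yc: "y \<in> carrier S" using x y flat_closed by auto
  have "\<not> at y \<subseteq> at x" using label_reflect[of y x y] xc yc y by auto
  then obtain a where a: "a \<in> atoms S" "a \<sqsubseteq> y" "\<not> a \<sqsubseteq> x" by (auto simp: at_def)
  have ac: "a \<in> carrier S" using a(1) by (rule atoms_closed)
  obtain u where u: "u \<in> joins S {x, a}" "u \<sqsubseteq> y" using bounded_joins[OF xc ac yc y(2) a(2)] by blast
  then have u': "u \<in> carrier S" "x \<sqsubseteq> u" "a \<sqsubseteq> u" using joins_label xc ac by auto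
  have "\<rho> u + \<rho> \<bottom> \<le> \<rho> x + \<rho> a" using submodular[OF xc ac u(1)] xc ac by simp
  moreover have "\<rho> x < \<rho> u" using flat_strict[OF x u'(1,2)] a u' by auto
  ultimately have "\<rho> u = Suc (\<rho> x)" using rho_atom[OF a(1)] by simp
  then show ?thesis
    using closure_flat[OF u'(1)] closure_least[OF u'(1) y(1) u(2)] rho_closure[OF u'(1)]
      le_trans[OF u'(2) closure_above[OF u'(1)]] closure_closed xc u'
    by (intro bexI[of _ "closure S \<rho> u"]) auto
qed

end

section \<open>The poset of flats is geometric\<close>

text \<open>
  The simple matroid scheme of a geometric poset \<open>P\<close> has as elements the pairs of a set of atoms
  of \<open>P\<close> and one of its joins. The joins have to be recorded because they are not unique.
\<close>

definition generated_elements :: "('a, 'c) gorder_scheme \<Rightarrow> ('a set \<times> 'a) set"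
  where "generated_elements P = {(A, y). A \<subseteq> atoms P \<and> y \<in> joins P A}"

text \<open>Coordinates for a scheme: carrier, order and \<rho> are all read off the pairs.
  \<open>P\<close> and these conditions alone determine the scheme up to isomorphism.\<close>

definition encodes ::
    "'a gorder \<Rightarrow> 'b gorder \<Rightarrow> ('b \<Rightarrow> nat) \<Rightarrow> ('b \<Rightarrow> 'a set \<times> 'a) \<Rightarrow> bool"
  where "encodes P S \<rho> e \<longleftrightarrow>
    bij_betw e (carrier S) (generated_elements P) \<and>
    (\<forall>s\<in>carrier S. \<forall>t\<in>carrier S.
      s \<sqsubseteq>\<^bsub>S\<^esub> t \<longleftrightarrow> fst (e s) \<subseteq> fst (e t) \<and> snd (e s) \<sqsubseteq>\<^bsub>P\<^esub> snd (e t)) \<and>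
    (\<forall>s\<in>carrier S. \<rho> s = poset_rank P (snd (e s)))"

locale flat_representation = plain_matroid_scheme S \<rho> + P: partial_order P
  for S :: "'b gorder" (structure) and \<rho> and P :: "'a gorder" +
  fixes f :: "'a \<Rightarrow> 'b"
  assumes f_bij: "bij_betw f (carrier P) (flats S \<rho>)"
    and f_le: "\<lbrakk>x \<in> carrier P; y \<in> carrier P\<rbrakk> \<Longrightarrow> f x \<sqsubseteq> f y \<longleftrightarrow> x \<sqsubseteq>\<^bsub>P\<^esub> y"
begin

lemma f_flat: "x \<in> carrier P \<Longrightarrow> f x \<in> flats S \<rho>"
  using bij_betw_apply[OF f_bij] .

lemma f_closed: "x \<in> carrier P \<Longrightarrow> f x \<in> carrier S"
  using f_flat flat_closed by blast

lemma f_inj: "\<lbrakk>x \<in> carrier P; y \<in> carrier P; f x = f y\<rbrakk> \<Longrightarrow> x = y"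
  using f_bij by (auto simp: bij_betw_def inj_on_def)

lemma f_surj: "y \<in> flats S \<rho> \<Longrightarrow> \<exists>x\<in>carrier P. f x = y"
  using f_bij unfolding bij_betw_def by (metis imageE)

sublocale P: finite_pointed_poset P
proof
  have "closure S \<rho> \<bottom> \<in> flats S \<rho>" using closure_flat by simp
  then obtain p where p: "p \<in> carrier P" "f p = closure S \<rho> \<bottom>" using f_surj by blast
  have "p \<sqsubseteq>\<^bsub>P\<^esub> x" if x: "x \<in> carrier P" for x
  proof -
    have "f p \<sqsubseteq> f x"
      unfolding p(2) by (rule closure_least) (use f_flat[OF x] f_closed[OF x] in auto)
    then show ?thesis using f_le[OF p(1) x] by simp
  qed
  then show "\<exists>x. least P x (carrier P)" using p by (auto simp: least_def)
  have "finite (flats S \<rho>)"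
    using finite_carrier flat_closed finite_subset[of "flats S \<rho>" "carrier S"] by blast
  then show "finite (carrier P)" using bij_betw_finite[OF f_bij] by simp
qed

lemma f_bottom: "f \<bottom>\<^bsub>P\<^esub> = closure S \<rho> \<bottom>"
proof -
  have "closure S \<rho> \<bottom> \<in> flats S \<rho>" using closure_flat by simp
  then obtain p where p: "p \<in> carrier P" "f p = closure S \<rho> \<bottom>" using f_surj by blast
  have fb: "f \<bottom>\<^bsub>P\<^esub> \<in> flats S \<rho>" using f_flat by simp
  have "closure S \<rho> \<bottom> \<sqsubseteq> f \<bottom>\<^bsub>P\<^esub>"
    by (rule closure_least) (use fb flat_closed[OF fb] in auto)
  then have "p \<sqsubseteq>\<^bsub>P\<^esub> \<bottom>\<^bsub>P\<^esub>" using f_le[of p "\<bottom>\<^bsub>P\<^esub>"] p by simp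
  then show ?thesis using P.least_eq_bottom[OF p(1)] p by simp
qed

text \<open>By \<open>add_atom\<close> there is a flat of the next rank between two comparable
  distinct flats; for a cover it must be the upper one.\<close>

lemma rank_function_P: "rank_function P (\<lambda>x. \<rho> (f x))"
  unfolding rank_function_def
proof (intro conjI ballI impI)
  show "\<rho> (f \<bottom>\<^bsub>P\<^esub>) = 0" using f_bottom rho_closure rho_bottom by simp
next
  fix x y assume "x \<in> carrier P" "y \<in> carrier P" "x \<sqsubseteq>\<^bsub>P\<^esub> y"
  then show "\<rho> (f x) \<le> \<rho> (f y)" using M2 f_closed f_le by simp
next
  fix x y assume x: "x \<in> carrier P" and y: "y \<in> carrier P" and c: "covers P x y"
  have xy: "x \<sqsubseteq>\<^bsub>P\<^esub> y" "x \<noteq> y" using c by (auto simp: covers_def P.lless_eq)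
  then have "f x \<sqsubseteq> f y" "f x \<noteq> f y" using f_le f_inj x y by auto
  then obtain z where z: "z \<in> flats S \<rho>" "f x \<sqsubseteq> z" "z \<sqsubseteq> f y" "\<rho> z = Suc (\<rho> (f x))"
    using add_atom[OF f_flat[OF x] f_flat[OF y]] by blast
  obtain p where p: "p \<in> carrier P" "f p = z" using f_surj z by blast
  have "x \<sqsubseteq>\<^bsub>P\<^esub> p" "p \<sqsubseteq>\<^bsub>P\<^esub> y" "x \<noteq> p" using p z f_le x y by auto
  then have "p = y" using c p by (auto simp: covers_def P.lless_eq)
  then show "\<rho> (f y) = Suc (\<rho> (f x))" using z p by simp
qed

lemma poset_rank_P: "x \<in> carrier P \<Longrightarrow> poset_rank P x = \<rho> (f x)"
  using P.poset_rank_eq[OF rank_function_P] .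

lemma closure_in_P: "s \<in> carrier S \<Longrightarrow> \<exists>p\<in>carrier P. f p = closure S \<rho> s"
  using f_surj closure_flat by blast

text \<open>An adjunction: closure followed by the inverse of \<open>f\<close> is left adjoint to
  \<open>f\<close>. Order questions between flats become questions in \<open>S\<close> about
  unclosed representatives.\<close>

lemma closure_le_iff:
  assumes "s \<in> carrier S" "p \<in> carrier P" "f p = closure S \<rho> s" "w \<in> carrier P"
  shows "p \<sqsubseteq>\<^bsub>P\<^esub> w \<longleftrightarrow> s \<sqsubseteq> f w"
proof
  assume "p \<sqsubseteq>\<^bsub>P\<^esub> w"
  then have "closure S \<rho> s \<sqsubseteq> f w" using f_le assms by metis
  then show "s \<sqsubseteq> f w"
    using le_trans[OF closure_above[OF assms(1)], of "f w"] closure_closed f_closed assms by simp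
next
  assume "s \<sqsubseteq> f w"
  then have "f p \<sqsubseteq> f w" using closure_least f_flat assms by simp
  then show "p \<sqsubseteq>\<^bsub>P\<^esub> w" using f_le[OF assms(2,4)] by simp
qed

text \<open>The join under \<open>m\<close> is the closure of the join taken in \<open>S\<close>
  under \<open>f m\<close>, the meet is the closure of the meet. Closing preserves \<rho>, so
  submodularity carries over.\<close>

lemma geometric_interval_P:
  assumes m: "m \<in> carrier P"
  shows "geometric_interval P (\<lambda>x. \<rho> (f x)) m"
  unfolding geometric_interval_def
proof (intro ballI impI conjI)
  fix x z assume x: "x \<in> carrier P" "x \<sqsubseteq>\<^bsub>P\<^esub> m" and z: "z \<in> carrier P" "z \<sqsubseteq>\<^bsub>P\<^esub> m"
    and at: "\<forall>a\<in>carrier P. \<rho> (f a) = 1 \<longrightarrow> a \<sqsubseteq>\<^bsub>P\<^esub> x \<longrightarrow> a \<sqsubseteq>\<^bsub>P\<^esub> z"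
  have "f x \<sqsubseteq> f z"
  proof (rule below_flatI[of _ _ "f m"])
    fix a assume a: "a \<in> atoms S" "a \<sqsubseteq> f x" "\<rho> a = 1"
    have ac: "a \<in> carrier S" using a(1) by (rule atoms_closed)
    obtain p where p: "p \<in> carrier P" "f p = closure S \<rho> a" using closure_in_P[OF ac] by blast
    have "p \<sqsubseteq>\<^bsub>P\<^esub> x" using closure_le_iff[OF ac p x(1)] a by simp
    moreover have "\<rho> (f p) = 1" using p rho_closure[OF ac] a by simp
    ultimately have "p \<sqsubseteq>\<^bsub>P\<^esub> z" using at p by blast
    then show "a \<sqsubseteq> f z" using closure_le_iff[OF ac p z(1)] by simp
  qed (use x z m f_flat f_closed f_le in auto)
  then show "x \<sqsubseteq>\<^bsub>P\<^esub> z" using f_le x z by simp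
next
  fix x z assume x: "x \<in> carrier P" "x \<sqsubseteq>\<^bsub>P\<^esub> m" and z: "z \<in> carrier P" "z \<sqsubseteq>\<^bsub>P\<^esub> m"
  note c = f_closed[OF x(1)] f_closed[OF z(1)] f_closed[OF m]
  have fm: "f x \<sqsubseteq> f m" "f z \<sqsubseteq> f m" using f_le x z m by simp_all
  obtain u where u: "u \<in> joins S {f x, f z}" "u \<sqsubseteq> f m" using bounded_joins[OF c fm] by blast
  then have u': "u \<in> carrier S" "f x \<sqsubseteq> u" "f z \<sqsubseteq> u" "at u = at (f x) \<union> at (f z)"
    using joins_label c by auto
  obtain l where l: "l \<in> carrier S" "l \<sqsubseteq> f x" "l \<sqsubseteq> f z" "\<forall>v\<in>carrier S. v \<sqsubseteq> f x \<longrightarrow> v \<sqsubseteq> f z \<longrightarrow> v \<sqsubseteq> l"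
    using bounded_meets[OF c fm] by blast
  obtain j' l' where j': "j' \<in> carrier P" "f j' = closure S \<rho> u" and l': "l' \<in> carrier P" "f l' = closure S \<rho> l"
    using closure_in_P u'(1) l(1) by blast
  have "u \<sqsubseteq> closure S \<rho> u" "closure S \<rho> u \<in> carrier S" using closure_above closure_closed u' by auto
  then have "f x \<sqsubseteq> f j'" "f z \<sqsubseteq> f j'"
    using le_trans[OF u'(2), of "f j'"] le_trans[OF u'(3), of "f j'"] u'(1) c j' by simp_all
  then have "x \<sqsubseteq>\<^bsub>P\<^esub> j'" "z \<sqsubseteq>\<^bsub>P\<^esub> j'" using f_le[OF x(1) j'(1)] f_le[OF z(1) j'(1)] by simp_all
  moreover have "w \<sqsubseteq>\<^bsub>P\<^esub> m \<longrightarrow> x \<sqsubseteq>\<^bsub>P\<^esub> w \<longrightarrow> z \<sqsubseteq>\<^bsub>P\<^esub> w \<longrightarrow> j' \<sqsubseteq>\<^bsub>P\<^esub> w" if w: "w \<in> carrier P" for w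
  proof (intro impI)
    assume "w \<sqsubseteq>\<^bsub>P\<^esub> m" "x \<sqsubseteq>\<^bsub>P\<^esub> w" "z \<sqsubseteq>\<^bsub>P\<^esub> w"
    then have fw: "f w \<sqsubseteq> f m" "f x \<sqsubseteq> f w" "f z \<sqsubseteq> f w" using f_le x z m w by simp_all
    \<comment> \<open>Inclusion of atoms suffices here because \<open>u\<close> and
      \<open>f w\<close> both lie under \<open>f m\<close>.\<close>
    have "at u \<subseteq> at (f w)"
      using u'(4) label_mono[OF c(1) f_closed[OF w] fw(2)] label_mono[OF c(2) f_closed[OF w] fw(3)] by simp
    then have "u \<sqsubseteq> f w" using label_reflect[OF u'(1) f_closed[OF w] c(3) u(2) fw(1)] by simp
    then show "j' \<sqsubseteq>\<^bsub>P\<^esub> w" using closure_le_iff[OF u'(1) j' w] by simp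
  qed
  moreover have "w \<sqsubseteq>\<^bsub>P\<^esub> l'" if w: "w \<in> carrier P" "w \<sqsubseteq>\<^bsub>P\<^esub> x" "w \<sqsubseteq>\<^bsub>P\<^esub> z" for w
  proof -
    have "f w \<sqsubseteq> l" using l w f_le x z f_closed by simp
    then have "f w \<sqsubseteq> f l'"
      using le_trans[OF _ closure_above[OF l(1)]] l' l(1) f_closed[OF w(1)] closure_closed[OF l(1)] by simp
    then show ?thesis using f_le[OF w(1) l'(1)] by simp
  qed
  moreover have "\<rho> (f j') + \<rho> (f l') \<le> \<rho> (f x) + \<rho> (f z)"
    using submodular[OF c(1,2) u(1) l(1-3)] rho_closure u' l j' l' by simp
  ultimately have "semimodular_bounds P (\<lambda>x. \<rho> (f x)) m x z j' l'"
    unfolding semimodular_bounds_def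
    using j' l' closure_le_iff[OF u'(1) j' m] closure_le_iff[OF l(1) l' x(1)] closure_le_iff[OF l(1) l' z(1)]
      u(2) l f_le x z by simp
  then show "\<exists>j l. semimodular_bounds P (\<lambda>x. \<rho> (f x)) m x z j l" by blast
qed

lemma geometric_P: "geometric_poset P"
proof (intro geometric_poset.intro ranked_poset.intro ranked_poset_axioms.intro geometric_poset_axioms.intro)
  show "partial_order P" by (rule P.partial_order_axioms)
  show "weak_partial_order_bottom P" by (rule P.weak_partial_order_bottom_axioms)
  show "\<exists>r. rank_function P r" using rank_function_P by blast
  fix m assume "m \<in> maximals P (carrier P)"
  then have m: "m \<in> carrier P" by (simp add: maximals_def)
  show "geometric_lattice (below P m)"
    using P.geometric_lattice_below[OF rank_function_P m geometric_interval_P[OF m]] .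
next
  fix x A y
  assume x: "x \<in> carrier P" and A: "A \<subseteq> atoms P" and y: "y \<in> joins P A"
    and rank: "poset_rank P x < poset_rank P y"
  have Ac: "a \<in> carrier P" "\<rho> (f a) = 1" if "a \<in> A" for a
    using that A poset_rank_P by (auto simp: atoms_def)
  have yU: "y \<in> Upper P A" and ymin: "\<And>v. \<lbrakk>v \<in> Upper P A; v \<sqsubseteq>\<^bsub>P\<^esub> y\<rbrakk> \<Longrightarrow> v = y"
    using y by (simp_all add: joins_def minimals_def)
  have yc: "y \<in> carrier P" and Ay: "\<And>a. a \<in> A \<Longrightarrow> a \<sqsubseteq>\<^bsub>P\<^esub> y"
    using yU Ac by (auto simp: Upper_def)
  have fyc: "f y \<in> carrier S" using f_closed[OF yc] .
  have "\<exists>t. t \<in> atoms S \<and> t \<sqsubseteq> f a \<and> \<rho> t = 1" if "a \<in> A" for a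
    using nonloop_below[OF f_closed[OF Ac(1)[OF that]]] Ac(2)[OF that] by auto
  then have "\<forall>a\<in>A. \<exists>t. t \<in> atoms S \<and> t \<sqsubseteq> f a \<and> \<rho> t = 1" by blast
  then obtain t where "\<forall>a\<in>A. t a \<in> atoms S \<and> t a \<sqsubseteq> f a \<and> \<rho> (t a) = 1"
    by (rule bchoice[THEN exE])
  then have t: "\<And>a. a \<in> A \<Longrightarrow> t a \<in> atoms S \<and> t a \<sqsubseteq> f a \<and> \<rho> (t a) = 1" by blast
  have tc: "t a \<in> carrier S" if "a \<in> A" for a using t[OF that] by (auto simp: atoms_def)
  have cl: "closure S \<rho> (t a) = f a" if "a \<in> A" for a
    using closure_nonloop[OF f_flat _ tc[OF that]] Ac t that by blast
  have ty: "t a \<sqsubseteq> f y" if "a \<in> A" for a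
    using closure_le_iff[OF tc[OF that] Ac(1)[OF that] cl[OF that, symmetric] yc] Ay that by simp
  have "t ` A \<subseteq> at (f y)" using t ty by (auto simp: at_def)
  \<comment> \<open>The atoms of \<open>y0\<close> are exactly the representatives, so the atom that
    M5 finds under it belongs to a member of \<open>A\<close>. Under \<open>f y\<close> it could be
    any atom.\<close>
  then obtain y0 where y0: "y0 \<in> carrier S" "y0 \<sqsubseteq> f y" "at y0 = t ` A"
    using label_restrict[OF fyc] by blast
  obtain p where p: "p \<in> carrier P" "f p = closure S \<rho> y0" using closure_in_P[OF y0(1)] by blast
  \<comment> \<open>The closure of \<open>y0\<close> corresponds to an upper bound of
    \<open>A\<close> under \<open>y\<close>, and the join \<open>y\<close> is minimal.\<close>
  have "p = y"
  proof (rule ymin)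
    show "p \<sqsubseteq>\<^bsub>P\<^esub> y" using closure_le_iff[OF y0(1) p yc] y0 by simp
    show "p \<in> Upper P A"
    proof (rule Upper_memI[OF _ p(1)])
      fix a assume a: "a \<in> A"
      have "t a \<sqsubseteq> y0" using y0(3) a by (auto simp: at_def)
      then have "t a \<sqsubseteq> f p"
        using le_trans[OF _ closure_above[OF y0(1)]] tc[OF a] y0(1) closure_closed[OF y0(1)] p(2) by simp
      then show "a \<sqsubseteq>\<^bsub>P\<^esub> p"
        using closure_le_iff[OF tc[OF a] Ac(1)[OF a] cl[OF a, symmetric] p(1)] by simp
    qed
  qed
  then have "\<rho> (f x) < \<rho> y0" using rank poset_rank_P x yc p rho_closure[OF y0(1)] by simp
  then obtain b where b: "b \<in> atoms S" "b \<sqsubseteq> y0" "\<not> b \<sqsubseteq> f x" "joins S {f x, b} \<noteq> {}"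
    using M5[OF f_closed[OF x] y0(1)] by blast
  then have "b \<in> at y0" by (simp add: at_def)
  then obtain a where a: "a \<in> A" "b = t a" using y0(3) by blast
  obtain u where "u \<in> joins S {f x, b}" using b by blast
  then have u: "u \<in> carrier S" "f x \<sqsubseteq> u" "b \<sqsubseteq> u" using joins_label f_closed x tc a by auto
  obtain q where q: "q \<in> carrier P" "f q = closure S \<rho> u" using closure_in_P[OF u(1)] by blast
  have uq: "v \<sqsubseteq> f q" if "v \<in> carrier S" "v \<sqsubseteq> u" for v
    using le_trans[OF that(2) closure_above[OF u(1)]] that u(1) closure_closed[OF u(1)] q(2) by simp
  have "x \<sqsubseteq>\<^bsub>P\<^esub> q" using uq[OF f_closed[OF x] u(2)] f_le[OF x q(1)] by simp
  moreover have "a \<sqsubseteq>\<^bsub>P\<^esub> q"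
    using closure_le_iff[OF tc[OF a(1)] Ac(1)[OF a(1)] cl[OF a(1), symmetric] q(1)] uq[OF tc[OF a(1)]] u a
    by simp
  ultimately have "q \<in> Upper P {a, x}" using q by (auto simp: Upper_def)
  then have "joins P {a, x} \<noteq> {}" using P.joins_below by blast
  moreover have "\<not> a \<sqsubseteq>\<^bsub>P\<^esub> x"
    using closure_le_iff[OF tc[OF a(1)] Ac(1)[OF a(1)] cl[OF a(1), symmetric] x] b a by simp
  ultimately show "\<exists>a\<in>A. \<not> a \<sqsubseteq>\<^bsub>P\<^esub> x \<and> joins P {a, x} \<noteq> {}" using a by blast
qed

section \<open>Uniqueness of the simple matroid scheme\<close>

text \<open>Simplicity makes the atoms of \<open>S\<close> rank-one flats, so \<open>f\<close>
  matches the atoms of \<open>P\<close> with those of \<open>S\<close>, and \<open>A s\<close> is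
  the atom set of \<open>s\<close> read in \<open>P\<close>.\<close>

lemma simple_encodes:
  assumes simple: "simple_matroid_scheme S \<rho>"
  shows "\<exists>e. encodes P S \<rho> e"
proof -
  have atS: "a \<in> flats S \<rho>" "\<rho> a = 1" "a \<in> carrier S" if "a \<in> atoms S" for a
    using simple that rho_atom[OF that] flat_closed
    by (auto simp: simple_matroid_scheme_def loop_def)
  have f_atom: "f a \<in> atoms S" if a: "a \<in> atoms P" for a
  proof -
    have ac: "a \<in> carrier P" "\<rho> (f a) = 1" using a poset_rank_P by (auto simp: atoms_def)
    then obtain b where b: "b \<in> atoms S" "b \<sqsubseteq> f a" "\<rho> b = 1"
      using nonloop_below[OF f_closed[OF ac(1)]] by auto
    then show ?thesis
      using closure_nonloop[OF f_flat[OF ac(1)] ac(2) atS(3)[OF b(1)] b(2,3)] flat_closure[OF atS(1)[OF b(1)]]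
      by simp
  qed
  have atom_f: "\<exists>a\<in>atoms P. f a = b" if b: "b \<in> atoms S" for b
  proof -
    obtain a where "a \<in> carrier P" "f a = b" using f_surj atS(1)[OF b] by blast
    then show ?thesis using atS[OF b] poset_rank_P by (auto simp: atoms_def)
  qed
  have "\<forall>s\<in>carrier S. \<exists>p. p \<in> carrier P \<and> f p = closure S \<rho> s"
    using closure_in_P by blast
  then obtain g where g: "\<And>s. s \<in> carrier S \<Longrightarrow> g s \<in> carrier P \<and> f (g s) = closure S \<rho> s"
    using bchoice[of "carrier S" "\<lambda>s p. p \<in> carrier P \<and> f p = closure S \<rho> s"] by blast
  define A where "A s = {a \<in> atoms P. f a \<sqsubseteq> s}" for s
  have f_A: "f ` A s = at s" for s
  proof (intro equalityI subsetI)
    fix b assume "b \<in> at s"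
    then have b: "b \<in> atoms S" "b \<sqsubseteq> s" by (auto simp: at_def)
    then obtain a where "a \<in> atoms P" "f a = b" using atom_f by blast
    then show "b \<in> f ` A s" using b by (auto simp: A_def)
  qed (use f_atom in \<open>auto simp: A_def at_def\<close>)
  have Ac: "a \<in> carrier P" if "a \<in> A s" for a s using that by (auto simp: A_def atoms_def)
  \<comment> \<open>The right-hand side does not yet place \<open>s\<close> below
    \<open>f w\<close>, for lack of a common upper bound.\<close>
  have upper: "w \<in> Upper P (A s) \<longleftrightarrow> w \<in> carrier P \<and> at s \<subseteq> at (f w)" for s w
  proof -
    have "w \<in> Upper P (A s) \<longleftrightarrow> w \<in> carrier P \<and> (\<forall>a\<in>A s. f a \<sqsubseteq> f w)"
      using Ac f_le by (auto simp: Upper_def)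
    also have "\<dots> \<longleftrightarrow> w \<in> carrier P \<and> at s \<subseteq> at (f w)"
      unfolding f_A[symmetric, of s] using f_atom by (auto simp: at_def A_def)
    finally show ?thesis .
  qed
  have cl_le: "g s \<sqsubseteq>\<^bsub>P\<^esub> w \<longleftrightarrow> s \<sqsubseteq> f w" if "s \<in> carrier S" "w \<in> carrier P" for s w
    using closure_le_iff[OF that(1) _ _ that(2)] g[OF that(1)] by blast
  have s_cl: "s \<sqsubseteq> f (g s)" if "s \<in> carrier S" for s
    using g closure_above that by simp
  define e where "e s = (A s, g s)" for s
  have gen: "e s \<in> generated_elements P" if s: "s \<in> carrier S" for s
  proof -
    have "g s \<in> Upper P (A s)"
      using upper g[OF s] label_mono[OF s f_closed s_cl[OF s]] by blast
    moreover have "v = g s" if v: "v \<in> Upper P (A s)" "v \<sqsubseteq>\<^bsub>P\<^esub> g s" for v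
    proof -
      have vc: "v \<in> carrier P" "at s \<subseteq> at (f v)" using v upper by auto
      \<comment> \<open>Now \<open>f (g s)\<close> is a common upper bound of \<open>s\<close> and
        \<open>f v\<close>, and inclusion of atoms gives \<open>s\<close> below
        \<open>f v\<close>.\<close>
      have "f v \<sqsubseteq> f (g s)" using f_le[of v "g s"] vc g[OF s] v by blast
      then have "s \<sqsubseteq> f v"
        using label_reflect[OF s f_closed[OF vc(1)] f_closed s_cl[OF s]] g[OF s] vc by blast
      then show ?thesis using cl_le[OF s vc(1)] v(2) g[OF s] vc by auto
    qed
    ultimately show ?thesis by (auto simp: generated_elements_def e_def joins_def minimals_def A_def)
  qed
  have le: "s \<sqsubseteq> t \<longleftrightarrow> A s \<subseteq> A t \<and> g s \<sqsubseteq>\<^bsub>P\<^esub> g t" if s: "s \<in> carrier S" and t: "t \<in> carrier S" for s t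
  proof
    assume st: "s \<sqsubseteq> t"
    have "A s \<subseteq> A t" using le_trans[OF _ st _ s t] atoms_closed[OF f_atom] by (auto simp: A_def)
    moreover have "g s \<sqsubseteq>\<^bsub>P\<^esub> g t"
      using cl_le[OF s] g[OF t] le_trans[OF st s_cl[OF t] s t f_closed] by blast
    ultimately show "A s \<subseteq> A t \<and> g s \<sqsubseteq>\<^bsub>P\<^esub> g t" ..
  next
    assume st: "A s \<subseteq> A t \<and> g s \<sqsubseteq>\<^bsub>P\<^esub> g t"
    then have "at s \<subseteq> at t" using f_A[of s, symmetric] f_A[of t, symmetric] by auto
    \<comment> \<open>The second coordinates provide the common upper bound \<open>f (g t)\<close>;
      inclusion of the first coordinates alone would not order \<open>s\<close> and
      \<open>t\<close>.\<close>
    moreover have "s \<sqsubseteq> f (g t)" using st cl_le[OF s] g[OF t] by blast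
    ultimately show "s \<sqsubseteq> t" using label_reflect[OF s t _ _ s_cl[OF t]] f_closed g[OF t] by blast
  qed
  have "inj_on e (carrier S)"
  proof (rule inj_onI)
    fix s t assume st: "s \<in> carrier S" "t \<in> carrier S" "e s = e t"
    then have "A s = A t" "g s = g t" by (simp_all add: e_def)
    then have "s \<sqsubseteq> t" "t \<sqsubseteq> s" using le[OF st(1,2)] le[OF st(2,1)] g[OF st(1)] g[OF st(2)] by auto
    then show "s = t" using st le_antisym by blast
  qed
  moreover have "\<exists>s\<in>carrier S. e s = (B, y)" if By: "(B, y) \<in> generated_elements P" for B y
  proof -
    have B: "B \<subseteq> atoms P" and y: "y \<in> joins P B" using By by (auto simp: generated_elements_def)
    have Bc: "B \<subseteq> carrier P" using B by (auto simp: atoms_def)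
    have yU: "y \<in> Upper P B" and ymin: "\<And>v. \<lbrakk>v \<in> Upper P B; v \<sqsubseteq>\<^bsub>P\<^esub> y\<rbrakk> \<Longrightarrow> v = y"
      using y by (simp_all add: joins_def minimals_def)
    have yc: "y \<in> carrier P" and By: "\<And>a. a \<in> B \<Longrightarrow> a \<sqsubseteq>\<^bsub>P\<^esub> y"
      using yU Bc by (auto simp: Upper_def)
    have "f ` B \<subseteq> at (f y)" using B By f_atom f_le yc Bc by (auto simp: at_def)
    then obtain s where s: "s \<in> carrier S" "s \<sqsubseteq> f y" "at s = f ` B"
      using label_restrict[OF f_closed[OF yc]] by blast
    have "A s = B"
    proof -
      have "f ` A s = f ` B" using f_A s by simp
      moreover have "inj_on f (carrier P)" using f_inj by (auto simp: inj_on_def)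
      ultimately show ?thesis using Bc Ac inj_on_image_eq_iff[of f "carrier P" "A s" B] by blast
    qed
    \<comment> \<open>As \<open>s\<close> is below \<open>f y\<close>, its closure gives an upper
      bound of \<open>B\<close> under the minimal upper bound \<open>y\<close>.\<close>
    moreover have "g s = y"
      using ymin[of "g s"] gen[OF s(1)] cl_le[OF s(1) yc] s(2) calculation
      by (auto simp: generated_elements_def e_def joins_def minimals_def)
    ultimately show ?thesis using s by (auto simp: e_def)
  qed
  moreover have "e ` carrier S = generated_elements P"
    using gen calculation(2) by (force simp: image_iff)
  ultimately have "bij_betw e (carrier S) (generated_elements P)"
    by (simp add: bij_betw_def)
  moreover have "\<rho> s = poset_rank P (g s)" if "s \<in> carrier S" for s
    using poset_rank_P g rho_closure that by simp
  ultimately show ?thesis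
    using le unfolding encodes_def by (intro exI[of _ e]) (simp add: e_def)
qed

end

section \<open>Comparing schemes through their encodings\<close>

lemma flat_representationI:
  assumes "partial_order P" "matroid_scheme S \<rho>" "poset_isomorphic P (flat_poset S \<rho>)"
  shows "\<exists>f. flat_representation S \<rho> P f"
proof -
  obtain f where f: "bij_betw f (carrier P) (flats S \<rho>)"
    "\<forall>x\<in>carrier P. \<forall>y\<in>carrier P. f x \<sqsubseteq>\<^bsub>S\<^esub> f y \<longleftrightarrow> x \<sqsubseteq>\<^bsub>P\<^esub> y"
    using assms(3) by (auto simp: poset_isomorphic_def poset_iso_def order_emb_def)
  have "flat_representation S \<rho> P f"
    by (intro flat_representation.intro plain_matroid_scheme.intro flat_representation_axioms.intro)
      (use assms f in auto)
  then show ?thesis by blast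
qed

lemma encodes_isomorphic:
  assumes e: "encodes P S \<rho> e" and e': "encodes P S' \<rho>' e'"
    and po: "weak_partial_order S" "weak_partial_order S'"
  shows "matroid_scheme_isomorphic S \<rho> S' \<rho>'"
proof -
  let ?G = "generated_elements P"
  define \<phi> where "\<phi> = the_inv_into (carrier S') e' \<circ> e"
  have b: "bij_betw e (carrier S) ?G" and b': "bij_betw e' (carrier S') ?G"
    using e e' by (auto simp: encodes_def)
  have bij: "bij_betw \<phi> (carrier S) (carrier S')"
    unfolding \<phi>_def using bij_betw_trans[OF b bij_betw_the_inv_into[OF b']] .
  have e\<phi>: "e' (\<phi> s) = e s" if "s \<in> carrier S" for s
    using f_the_inv_into_f_bij_betw[OF b'] bij_betw_apply[OF b that] by (simp add: \<phi>_def)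
  have \<phi>c: "\<phi> s \<in> carrier S'" if "s \<in> carrier S" for s using bij_betw_apply[OF bij that] .
  show ?thesis
    unfolding matroid_scheme_isomorphic_def poset_iso_def order_emb_def
    using bij po e e' e\<phi> \<phi>c by (intro exI[of _ \<phi>]) (simp add: encodes_def)
qed

section \<open>Joins of atoms in a geometric poset\<close>

locale finite_geometric_poset = geometric_poset P for P (structure) +
  assumes finite_P: "finite (carrier P)"

sublocale finite_geometric_poset \<subseteq> finite_pointed_poset P
  by unfold_locales (rule finite_P)

text \<open>A join relative to the interval under \<open>y\<close>: there it is a least upper bound,
  whereas members of \<open>joins\<close> are only minimal.\<close>

definition lub_below :: "('a, 'c) gorder_scheme \<Rightarrow> 'a \<Rightarrow> 'a set \<Rightarrow> 'a \<Rightarrow> bool"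
  where "lub_below L y A j \<longleftrightarrow> j \<in> carrier L \<and> j \<sqsubseteq>\<^bsub>L\<^esub> y \<and> (\<forall>a\<in>A. a \<sqsubseteq>\<^bsub>L\<^esub> j) \<and>
    (\<forall>w\<in>carrier L. w \<sqsubseteq>\<^bsub>L\<^esub> y \<longrightarrow> (\<forall>a\<in>A. a \<sqsubseteq>\<^bsub>L\<^esub> w) \<longrightarrow> j \<sqsubseteq>\<^bsub>L\<^esub> w)"

lemma joins_iff:
  assumes "A \<subseteq> carrier L"
  shows "y \<in> joins L A \<longleftrightarrow> y \<in> carrier L \<and> (\<forall>a\<in>A. a \<sqsubseteq>\<^bsub>L\<^esub> y) \<and>
    (\<forall>v\<in>carrier L. (\<forall>a\<in>A. a \<sqsubseteq>\<^bsub>L\<^esub> v) \<longrightarrow> v \<sqsubseteq>\<^bsub>L\<^esub> y \<longrightarrow> v = y)"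
proof -
  have "v \<in> Upper L A \<longleftrightarrow> v \<in> carrier L \<and> (\<forall>a\<in>A. a \<sqsubseteq>\<^bsub>L\<^esub> v)" for v
    using assms by (auto simp: Upper_def)
  then show ?thesis by (auto simp: joins_def minimals_def)
qed

context finite_geometric_poset
begin

lemma generated_elements_finite: "finite (generated_elements P)"
proof -
  have "generated_elements P \<subseteq> Pow (carrier P) \<times> carrier P"
    by (auto simp: generated_elements_def atoms_def joins_def minimals_def Upper_def)
  then show ?thesis using finite_P finite_subset by blast
qed

lemma interval_geometric:
  assumes m: "m \<in> carrier P"
  shows "geometric_interval P (poset_rank P) m"
proof -
  obtain M where M: "M \<in> maximals P (carrier P)" "m \<sqsubseteq> M" using maximal_above[OF m] by blast
  then have "M \<in> carrier P" by (simp add: maximals_def)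
  then show ?thesis
    using geometric_intervalI[OF rank_function_poset_rank _ G1[OF M(1)] m M(2)] by blast
qed

lemma atoms_detect_le:
  assumes "x \<in> carrier P" "z \<in> carrier P" "m \<in> carrier P" "x \<sqsubseteq> m" "z \<sqsubseteq> m"
    and "\<And>a. \<lbrakk>a \<in> atoms P; a \<sqsubseteq> x\<rbrakk> \<Longrightarrow> a \<sqsubseteq> z"
  shows "x \<sqsubseteq> z"
  using interval_geometric[OF assms(3)] assms unfolding geometric_interval_def atoms_def by blast

lemma semimodular_join:
  assumes "x \<in> carrier P" "z \<in> carrier P" "m \<in> carrier P" "x \<sqsubseteq> m" "z \<sqsubseteq> m"
  obtains j l where "semimodular_bounds P (poset_rank P) m x z j l"
  using interval_geometric[OF assms(3)] assms unfolding geometric_interval_def by blast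

lemma rank_strict:
  "\<lbrakk>x \<in> carrier P; y \<in> carrier P; x \<sqsubseteq> y; x \<noteq> y\<rbrakk> \<Longrightarrow> poset_rank P x < poset_rank P y"
  using rank_function_strict[OF rank_function_poset_rank] by (simp add: lless_eq)

lemma finite_atoms: "A \<subseteq> atoms P \<Longrightarrow> finite A"
  using finite_P finite_subset[of A "carrier P"] by (auto simp: atoms_def)

text \<open>A greedy construction. An atom already under \<open>j\<close> changes nothing; any other
  raises the rank by exactly one, semimodularity giving the upper bound. \<open>B\<close> keeps one
  atom per increase.\<close>

lemma basis_exists:
  assumes y: "y \<in> carrier P" and "finite A" and "A \<subseteq> atoms P" and "\<forall>a\<in>A. a \<sqsubseteq> y"
  shows "\<exists>j B. lub_below P y A j \<and> B \<subseteq> A \<and> lub_below P y B j \<and> card B = poset_rank P j"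
  using assms(2-)
proof (induction A rule: finite_induct)
  case empty
  have "lub_below P y {} \<bottom>" using y by (auto simp: lub_below_def)
  then show ?case using poset_rank_bottom by (intro exI[of _ \<bottom>] exI[of _ "{}"]) simp
next
  case (insert a A)
  then obtain j B where jB: "lub_below P y A j" "B \<subseteq> A" "lub_below P y B j" "card B = poset_rank P j"
    by auto
  have a: "a \<in> carrier P" "a \<sqsubseteq> y" "poset_rank P a = 1" using insert.prems by (auto simp: atoms_def)
  have j: "j \<in> carrier P" "j \<sqsubseteq> y" using jB by (auto simp: lub_below_def)
  show ?case
  proof (cases "a \<sqsubseteq> j")
    case True
    then have "lub_below P y (insert a A) j" using jB(1) by (auto simp: lub_below_def)
    then show ?thesis using jB by blast
  next
    case False
    obtain j' l where s: "semimodular_bounds P (poset_rank P) y j a j' l"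
      using semimodular_join[OF j(1) a(1) y j(2) a(2)] .
    then have j': "j' \<in> carrier P" "j' \<sqsubseteq> y" "j \<sqsubseteq> j'" "a \<sqsubseteq> j'"
      and least: "\<And>w. \<lbrakk>w \<in> carrier P; w \<sqsubseteq> y; j \<sqsubseteq> w; a \<sqsubseteq> w\<rbrakk> \<Longrightarrow> j' \<sqsubseteq> w"
      and "poset_rank P j' + poset_rank P l \<le> poset_rank P j + poset_rank P a"
      by (auto simp: semimodular_bounds_def)
    moreover have "poset_rank P j < poset_rank P j'"
      using rank_strict[OF j(1) j'(1,3)] False j'(4) by auto
    ultimately have rank: "poset_rank P j' = Suc (poset_rank P j)" using a by simp
    \<comment> \<open>Stated for an arbitrary \<open>C\<close> with join \<open>j\<close>, so that
      it applies both to \<open>A\<close> and to its basis \<open>B\<close>.\<close>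
    have lub: "lub_below P y (insert a C) j'" if C: "C \<subseteq> atoms P" "lub_below P y C j" for C
    proof -
      have "c \<sqsubseteq> j'" if "c \<in> C" for c
        using le_trans[of c j j'] C that j j' by (auto simp: lub_below_def atoms_def)
      then show ?thesis using C(2) j' least by (auto simp: lub_below_def)
    qed
    have "a \<notin> B" using False jB(3) by (auto simp: lub_below_def)
    moreover have "finite B" using jB(2) insert.hyps(1) finite_subset by blast
    ultimately have "card (insert a B) = poset_rank P j'" using rank jB(4) by simp
    then show ?thesis
      using lub[OF _ jB(1)] lub[OF _ jB(3)] jB(2) insert.prems
      by (intro exI[of _ j'] exI[of _ "insert a B"]) auto
  qed
qed

text \<open>The uniqueness of joins under a fixed element: the relative join from
  \<open>basis_exists\<close> lies below any minimal upper bound under \<open>y\<close>, hence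
  equals it.\<close>

lemma lub_below_joins:
  assumes A: "A \<subseteq> atoms P" and y: "y \<in> carrier P"
  shows "lub_below P y A j \<longleftrightarrow> j \<in> joins P A \<and> j \<sqsubseteq> y"
proof
  have Ac: "A \<subseteq> carrier P" using A by (auto simp: atoms_def)
  have lub_joins: "k \<in> joins P A" if k: "lub_below P y A k" for k
    unfolding joins_iff[OF Ac]
  proof (intro conjI ballI impI)
    fix v assume v: "v \<in> carrier P" "\<forall>a\<in>A. a \<sqsubseteq> v" "v \<sqsubseteq> k"
    then have "v \<sqsubseteq> y" using k y le_trans[of v k y] by (auto simp: lub_below_def)
    then show "v = k" using k v by (auto simp: lub_below_def)
  qed (use k in \<open>auto simp: lub_below_def\<close>)
  show "lub_below P y A j \<Longrightarrow> j \<in> joins P A \<and> j \<sqsubseteq> y"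
    using lub_joins by (simp add: lub_below_def)
  assume j: "j \<in> joins P A \<and> j \<sqsubseteq> y"
  then have j': "j \<in> carrier P" "\<forall>a\<in>A. a \<sqsubseteq> j" by (auto simp: joins_iff[OF Ac])
  then have "\<forall>a\<in>A. a \<sqsubseteq> y" using le_trans[of _ j y] j y Ac by auto
  then obtain k where k: "lub_below P y A k" using basis_exists[OF y finite_atoms[OF A] A] by blast
  then have "k \<sqsubseteq> j" using j j' by (simp add: lub_below_def)
  then have "k = j" using j k by (auto simp: joins_iff[OF Ac] lub_below_def)
  then show "lub_below P y A j" using k by simp
qed

lemma joins_atoms:
  assumes A: "A \<subseteq> atoms P" and y: "y \<in> joins P A"
  shows "y \<in> carrier P" and "a \<in> A \<Longrightarrow> a \<sqsubseteq> y"
    and "\<lbrakk>m \<in> carrier P; y \<sqsubseteq> m; w \<in> carrier P; w \<sqsubseteq> m; \<And>a. a \<in> A \<Longrightarrow> a \<sqsubseteq> w\<rbrakk> \<Longrightarrow> y \<sqsubseteq> w"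
proof -
  have "A \<subseteq> carrier P" using A by (auto simp: atoms_def)
  then show "y \<in> carrier P" "a \<in> A \<Longrightarrow> a \<sqsubseteq> y" using y joins_iff[of A P y] by auto
  assume m: "m \<in> carrier P" "y \<sqsubseteq> m" "w \<in> carrier P" "w \<sqsubseteq> m" "\<And>a. a \<in> A \<Longrightarrow> a \<sqsubseteq> w"
  then have "lub_below P m A y" using lub_below_joins[OF A m(1)] y by simp
  then show "y \<sqsubseteq> w" using m by (simp add: lub_below_def)
qed

text \<open>Supplies the cardinality equation that G2 asks for, and the bound of M1.\<close>

lemma joins_atoms_basis:
  assumes A: "A \<subseteq> atoms P" and y: "y \<in> joins P A"
  shows "\<exists>B\<subseteq>A. y \<in> joins P B \<and> card B = poset_rank P y"
proof -
  note j = joins_atoms[OF A y]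
  obtain k B where k: "lub_below P y A k" "B \<subseteq> A" "lub_below P y B k" "card B = poset_rank P k"
    using basis_exists[OF j(1) finite_atoms[OF A] A] j(2) by blast
  have "B \<subseteq> atoms P" using k(2) A by simp
  moreover have "k = y"
    using k(1) lub_below_joins[OF A j(1), of k] y joins_iff[of A P y] A
    by (auto simp: lub_below_def atoms_def)
  ultimately show ?thesis using k(2-4) lub_below_joins[of B y k] j(1) by auto
qed

lemma joins_subset:
  assumes A: "A \<subseteq> atoms P" and y: "y \<in> joins P A" and B: "B \<subseteq> A"
  shows "\<exists>z\<in>joins P B. z \<sqsubseteq> y"
  by (rule joins_below) (use joins_atoms(1,2)[OF A y] B in \<open>auto simp: Upper_def\<close>)

text \<open>Makes a join provided by G2 the second coordinate of a new pair: below \<open>w\<close>,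
  every upper bound of \<open>A\<close> is above \<open>y\<close>.\<close>

lemma joins_insertI:
  assumes A: "A \<subseteq> atoms P" "y \<in> joins P A" and a: "a \<in> atoms P" and w: "w \<in> joins P {a, y}"
  shows "w \<in> joins P (insert a A)"
proof -
  have Ac: "insert a A \<subseteq> carrier P" using A a by (auto simp: atoms_def)
  note y = joins_atoms[OF A]
  have w': "w \<in> carrier P" "a \<sqsubseteq> w" "y \<sqsubseteq> w"
    and wmin: "\<And>v. \<lbrakk>v \<in> carrier P; a \<sqsubseteq> v; y \<sqsubseteq> v; v \<sqsubseteq> w\<rbrakk> \<Longrightarrow> v = w"
    using w y(1) Ac joins_iff[of "{a, y}" P] by auto
  show ?thesis
    unfolding joins_iff[OF Ac]
  proof (intro conjI ballI impI)
    fix b assume "b \<in> insert a A"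
    then show "b \<sqsubseteq> w" using w' y(2)[of b] y(1) Ac le_trans[of b y w] by auto
  next
    fix v assume v: "v \<in> carrier P" "\<forall>b\<in>insert a A. b \<sqsubseteq> v" "v \<sqsubseteq> w"
    then have "y \<sqsubseteq> v" using y(3)[OF w'(1,3) v(1,3)] by blast
    then show "v = w" using wmin v by blast
  qed (rule w'(1))
qed

lemma joins_atoms_below:
  assumes y: "y \<in> carrier P"
  shows "y \<in> joins P {a \<in> atoms P. a \<sqsubseteq> y}"
proof -
  have c: "{a \<in> atoms P. a \<sqsubseteq> y} \<subseteq> carrier P" by (auto simp: atoms_def)
  have "v = y" if "v \<in> carrier P" "v \<sqsubseteq> y" "\<forall>a\<in>{a \<in> atoms P. a \<sqsubseteq> y}. a \<sqsubseteq> v" for v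
    using atoms_detect_le[OF y that(1) y] that y by auto
  then show ?thesis unfolding joins_iff[OF c] using y by auto
qed

lemma joins_atom: "a \<in> atoms P \<Longrightarrow> y \<in> joins P {a} \<longleftrightarrow> y = a"
  using joins_iff[of "{a}" P] by (auto simp: atoms_def)

lemma equal_rank:
  "\<lbrakk>x \<in> carrier P; y \<in> carrier P; x \<sqsubseteq> y; poset_rank P x = poset_rank P y\<rbrakk> \<Longrightarrow> x = y"
  using rank_strict[of x y] by auto

end

section \<open>The simple matroid scheme of a geometric poset\<close>

text \<open>The predicate \<open>encodes\<close> leaves \<open>eq\<close> open, hence the extra
  assumption. \<open>S\<close> stays abstract so that its carrier can be chosen in
  \<open>nat\<close> afterwards.\<close>

locale geometric_encoding = finite_geometric_poset P for P :: "'a gorder" (structure) +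
  fixes S :: "'b gorder" and \<rho> and e
  assumes enc: "encodes P S \<rho> e" and eq_S: "eq S = (=)"
begin

definition \<alpha> where "\<alpha> s = fst (e s)"
definition \<sigma> where "\<sigma> s = snd (e s)"

lemma e_inj: "\<lbrakk>s \<in> carrier S; t \<in> carrier S; \<alpha> s = \<alpha> t; \<sigma> s = \<sigma> t\<rbrakk> \<Longrightarrow> s = t"
  using enc unfolding encodes_def bij_betw_def inj_on_def \<alpha>_def \<sigma>_def by (simp add: prod_eq_iff)

lemma label:
  assumes "s \<in> carrier S"
  shows "\<alpha> s \<subseteq> atoms P" and "\<sigma> s \<in> joins P (\<alpha> s)" and "\<sigma> s \<in> carrier P"
proof -
  have "e s \<in> generated_elements P"
    using enc assms by (auto simp: encodes_def dest: bij_betw_apply)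
  then show "\<alpha> s \<subseteq> atoms P" "\<sigma> s \<in> joins P (\<alpha> s)" by (auto simp: generated_elements_def \<alpha>_def \<sigma>_def)
  then show "\<sigma> s \<in> carrier P" using joins_atoms(1) by blast
qed

lemma decode:
  assumes "A \<subseteq> atoms P" "y \<in> joins P A"
  shows "\<exists>s\<in>carrier S. \<alpha> s = A \<and> \<sigma> s = y"
proof -
  have "(A, y) \<in> e ` carrier S"
    using enc assms by (auto simp: encodes_def bij_betw_def generated_elements_def)
  then obtain s where "s \<in> carrier S" "e s = (A, y)" by (metis imageE)
  then show ?thesis by (intro bexI[of _ s]) (simp_all add: \<alpha>_def \<sigma>_def)
qed

lemma le_S: "\<lbrakk>s \<in> carrier S; t \<in> carrier S\<rbrakk> \<Longrightarrow> s \<sqsubseteq>\<^bsub>S\<^esub> t \<longleftrightarrow> \<alpha> s \<subseteq> \<alpha> t \<and> \<sigma> s \<sqsubseteq> \<sigma> t"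
  using enc by (simp add: encodes_def \<alpha>_def \<sigma>_def)

lemma rho_S: "s \<in> carrier S \<Longrightarrow> \<rho> s = poset_rank P (\<sigma> s)"
  using enc by (simp add: encodes_def \<sigma>_def)

sublocale S: partial_order S
proof
  fix x y z assume x: "x \<in> carrier S" and y: "y \<in> carrier S" and z: "z \<in> carrier S"
    and le: "x \<sqsubseteq>\<^bsub>S\<^esub> y" "y \<sqsubseteq>\<^bsub>S\<^esub> z"
  then show "x \<sqsubseteq>\<^bsub>S\<^esub> z"
    using le_S label(3) le_trans[of "\<sigma> x" "\<sigma> y" "\<sigma> z"] by auto
next
  fix x y assume x: "x \<in> carrier S" and y: "y \<in> carrier S" and le: "x \<sqsubseteq>\<^bsub>S\<^esub> y" "y \<sqsubseteq>\<^bsub>S\<^esub> x"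
  then have "\<alpha> x = \<alpha> y" "\<sigma> x = \<sigma> y" using le_S label(3) by auto
  then show "x .=\<^bsub>S\<^esub> y" using e_inj x y eq_S by simp
qed (use eq_S le_S label(3) in auto)

text \<open>Reflection holds because joins of atoms are least below a common bound, restriction
  because a smaller set of atoms has a join under the given one.\<close>

sublocale S: labelled_poset S \<alpha>
proof
  obtain b where b: "b \<in> carrier S" "\<alpha> b = {}" "\<sigma> b = \<bottom>"
    using decode[of "{}" \<bottom>] joins_iff[of "{}" P] least_eq_bottom by auto
  then show "\<exists>x. least S x (carrier S)"
    using le_S label(3) by (intro exI[of _ b]) (auto simp: least_def)
  show "finite (carrier S)"
    using enc bij_betw_finite generated_elements_finite by (auto simp: encodes_def)
next
  fix x assume x: "x \<in> carrier S"
  then show "finite (\<alpha> x)" using finite_atoms label by blast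
next
  fix x y assume "x \<in> carrier S" "y \<in> carrier S" "x \<sqsubseteq>\<^bsub>S\<^esub> y"
  then show "\<alpha> x \<subseteq> \<alpha> y" using le_S by blast
next
  fix x y u assume x: "x \<in> carrier S" "x \<sqsubseteq>\<^bsub>S\<^esub> u" and y: "y \<in> carrier S" "y \<sqsubseteq>\<^bsub>S\<^esub> u"
    and u: "u \<in> carrier S" and sub: "\<alpha> x \<subseteq> \<alpha> y"
  have "\<sigma> x \<sqsubseteq> \<sigma> u" "\<sigma> y \<sqsubseteq> \<sigma> u" using x y u le_S by auto
  moreover have "a \<sqsubseteq> \<sigma> y" if "a \<in> \<alpha> x" for a
    using joins_atoms(2)[OF label(1,2)[OF y(1)]] that sub by blast
  ultimately have "\<sigma> x \<sqsubseteq> \<sigma> y"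
    using joins_atoms(3)[OF label(1,2)[OF x(1)] label(3)[OF u] _ label(3)[OF y(1)]] by blast
  then show "x \<sqsubseteq>\<^bsub>S\<^esub> y" using le_S x y sub by simp
next
  fix x B assume x: "x \<in> carrier S" and B: "B \<subseteq> \<alpha> x"
  obtain z where z: "z \<in> joins P B" "z \<sqsubseteq> \<sigma> x" using joins_subset[OF label(1,2)[OF x] B] by blast
  have "B \<subseteq> atoms P" using B label(1)[OF x] by blast
  then obtain y where "y \<in> carrier S" "\<alpha> y = B" "\<sigma> y = z" using decode z by blast
  then show "\<exists>y\<in>carrier S. y \<sqsubseteq>\<^bsub>S\<^esub> x \<and> \<alpha> y = B" using le_S x B z by auto
qed

lemma joins_S_nonempty:
  assumes "x \<in> carrier S" "y \<in> carrier S" "u \<in> carrier S" "x \<sqsubseteq>\<^bsub>S\<^esub> u" "y \<sqsubseteq>\<^bsub>S\<^esub> u"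
  shows "joins S {x, y} \<noteq> {}"
  using S.bounded_joins[OF assms] by blast

lemma atom_S: "a \<in> atoms P \<Longrightarrow> \<exists>t\<in>atoms S. \<alpha> t = {a} \<and> \<sigma> t = a"
  using decode[of "{a}" a] joins_atom[of a a] by (auto simp: S.atoms_label)

lemma matroid_scheme_S: "matroid_scheme S \<rho>"
proof (intro matroid_scheme.intro matroid_scheme_axioms.intro)
  show "simplicial_poset S" by (rule S.simplicial)
next
  fix x assume x: "x \<in> carrier S"
  obtain B where B: "B \<subseteq> \<alpha> x" "card B = poset_rank P (\<sigma> x)"
    using joins_atoms_basis[OF label(1,2)[OF x]] by blast
  then show "\<rho> x \<le> poset_rank S x"
    using rho_S[OF x] S.poset_rank_label[OF x] card_mono[OF S.finite_label[OF x] B(1)] by simp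
next
  fix x y assume "x \<in> carrier S" "y \<in> carrier S" "x \<sqsubseteq>\<^bsub>S\<^esub> y"
  then show "\<rho> x \<le> \<rho> y" using le_S label(3) rho_S poset_rank_mono by simp
next
  fix x y u assume x: "x \<in> carrier S" and y: "y \<in> carrier S" and "u \<in> joins S {x, y}"
  then have u: "u \<in> carrier S" "x \<sqsubseteq>\<^bsub>S\<^esub> u" "y \<sqsubseteq>\<^bsub>S\<^esub> u" "\<alpha> u = \<alpha> x \<union> \<alpha> y"
    using S.joins_label by auto
  obtain m where m: "meets S {x, y} = {m}" "m \<in> carrier S" "m \<sqsubseteq>\<^bsub>S\<^esub> x" "m \<sqsubseteq>\<^bsub>S\<^esub> y"
    using S.bounded_meets[OF x y u(1-3)] by blast
  note \<sigma> = label(3)[OF x] label(3)[OF y] label(3)[OF u(1)]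
  have xyu: "\<sigma> x \<sqsubseteq> \<sigma> u" "\<sigma> y \<sqsubseteq> \<sigma> u" using le_S x y u by auto
  obtain j l where "semimodular_bounds P (poset_rank P) (\<sigma> u) (\<sigma> x) (\<sigma> y) j l"
    using semimodular_join[OF \<sigma> xyu] .
  then have j: "j \<in> carrier P" "j \<sqsubseteq> \<sigma> u" "\<sigma> x \<sqsubseteq> j" "\<sigma> y \<sqsubseteq> j"
    and l: "l \<in> carrier P" "\<And>w. \<lbrakk>w \<in> carrier P; w \<sqsubseteq> \<sigma> x; w \<sqsubseteq> \<sigma> y\<rbrakk> \<Longrightarrow> w \<sqsubseteq> l"
    and le: "poset_rank P j + poset_rank P l \<le> poset_rank P (\<sigma> x) + poset_rank P (\<sigma> y)"
    by (auto simp: semimodular_bounds_def)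
  have bound: "a \<sqsubseteq> j" if z: "z \<in> carrier S" "\<sigma> z \<sqsubseteq> j" "a \<in> \<alpha> z" for a z
    using joins_atoms(2)[OF label(1,2)[OF z(1)] z(3)] label(1,3)[OF z(1)] z j
      le_trans[of a "\<sigma> z" j] by (auto simp: atoms_def)
  then have "a \<sqsubseteq> j" if "a \<in> \<alpha> u" for a using that u(4) x y j by blast
  \<comment> \<open>The atoms of \<open>u\<close> come from \<open>x\<close> and \<open>y\<close>
    and so lie under the join \<open>j\<close> formed in \<open>P\<close>. For the meet,
    \<open>\<sigma> m\<close> may lie strictly under \<open>l\<close>; its rank stands on the
    smaller side of M3, so the inequality suffices.\<close>
  then have "\<sigma> u \<sqsubseteq> j"
    using joins_atoms(3)[OF label(1,2)[OF u(1)] \<sigma>(3) le_refl[OF \<sigma>(3)] j(1,2)] by blast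
  then have "poset_rank P (\<sigma> u) \<le> poset_rank P j" using poset_rank_mono \<sigma> j by blast
  moreover have "\<sigma> m \<sqsubseteq> l" using l(2)[OF label(3)[OF m(2)]] le_S m x y by simp
  then have "poset_rank P (\<sigma> m) \<le> poset_rank P l" using poset_rank_mono label(3)[OF m(2)] l by blast
  ultimately show "\<rho> u + \<rho> (the_elem (meets S {x, y})) \<le> \<rho> x + \<rho> y"
    using le m(1,2) x y u(1) rho_S by simp
next
  fix x y l assume x: "x \<in> carrier S" and y: "y \<in> carrier S" and "l \<in> meets S {x, y}"
    and eq: "\<rho> x = \<rho> l"
  then have l: "l \<in> carrier S" "l \<sqsubseteq>\<^bsub>S\<^esub> x" "l \<sqsubseteq>\<^bsub>S\<^esub> y"
    by (auto simp: meets_def maximals_def Lower_def)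
  have "\<sigma> l = \<sigma> x"
    using equal_rank[OF label(3)[OF l(1)] label(3)[OF x]] le_S l x eq rho_S by simp
  then have xy: "\<sigma> x \<sqsubseteq> \<sigma> y" using le_S[OF l(1) y] l by simp
  have A: "\<alpha> x \<union> \<alpha> y \<subseteq> atoms P" using label(1) x y by blast
  have "a \<sqsubseteq> \<sigma> y" if "a \<in> \<alpha> x" for a
    using joins_atoms(2)[OF label(1,2)[OF x] that] label(1,3)[OF x] label(3)[OF y] that xy
      le_trans[of a "\<sigma> x" "\<sigma> y"] by (auto simp: atoms_def)
  \<comment> \<open>Adding atoms that are already under \<open>\<sigma> y\<close> keeps it a minimal
    upper bound, so the enlarged pair is an element above both \<open>x\<close> and
    \<open>y\<close>.\<close>
  then have "\<sigma> y \<in> joins P (\<alpha> x \<union> \<alpha> y)"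
    using label(2)[OF y] by (auto simp: joins_def minimals_def Upper_def)
  then obtain u where "u \<in> carrier S" "\<alpha> u = \<alpha> x \<union> \<alpha> y" "\<sigma> u = \<sigma> y" using decode[OF A] by blast
  then show "joins S {x, y} \<noteq> {}"
    using joins_S_nonempty[OF x y, of u] le_S x y xy label(3)[OF y] by simp
next
  fix x y assume x: "x \<in> carrier S" and y: "y \<in> carrier S" and lt: "\<rho> x < \<rho> y"
  \<comment> \<open>G2 requires as many atoms as the rank, so the atoms of \<open>y\<close> are cut
    down to a basis.\<close>
  obtain B where B: "B \<subseteq> \<alpha> y" "\<sigma> y \<in> joins P B" "card B = poset_rank P (\<sigma> y)"
    using joins_atoms_basis[OF label(1,2)[OF y]] by blast
  have "B \<subseteq> atoms P" using B label(1)[OF y] by blast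
  then obtain a where a: "a \<in> B" "\<not> a \<sqsubseteq> \<sigma> x" "joins P {a, \<sigma> x} \<noteq> {}"
    using G2[OF label(3)[OF x] _ B(2) _ B(3)[symmetric]] lt rho_S[OF x] rho_S[OF y] by auto
  then have aP: "a \<in> atoms P" "a \<in> carrier P" using \<open>B \<subseteq> atoms P\<close> by (auto simp: atoms_def)
  obtain w where w: "w \<in> joins P {a, \<sigma> x}" using a by blast
  then have w': "a \<sqsubseteq> w" "\<sigma> x \<sqsubseteq> w" using joins_iff[of "{a, \<sigma> x}" P] aP label(3)[OF x] by auto
  \<comment> \<open>Adding \<open>a\<close> to \<open>x\<close> gives the pair \<open>u\<close>, an
    upper bound of \<open>x\<close> and of the atom \<open>t\<close> coded by
    \<open>a\<close>.\<close>
  obtain u where u: "u \<in> carrier S" "\<alpha> u = insert a (\<alpha> x)" "\<sigma> u = w"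
    using decode[OF _ joins_insertI[OF label(1,2)[OF x] aP(1) w]] aP(1) label(1)[OF x] by blast
  obtain t where t: "t \<in> atoms S" "\<alpha> t = {a}" "\<sigma> t = a" using atom_S[OF aP(1)] by blast
  then have tc: "t \<in> carrier S" by (simp add: atoms_def)
  have "t \<sqsubseteq>\<^bsub>S\<^esub> y" using le_S[OF tc y] t a B joins_atoms(2)[OF label(1,2)[OF y]] by auto
  moreover have "\<not> t \<sqsubseteq>\<^bsub>S\<^esub> x" using le_S[OF tc x] t a by simp
  moreover have "joins S {x, t} \<noteq> {}"
    using joins_S_nonempty[OF x tc u(1)] le_S x tc u t w' by auto
  ultimately show "\<exists>a\<in>atoms S. a \<sqsubseteq>\<^bsub>S\<^esub> y \<and> \<not> a \<sqsubseteq>\<^bsub>S\<^esub> x \<and> joins S {x, a} \<noteq> {}" using t by blast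
qed

sublocale M: plain_matroid_scheme S \<rho>
  by (intro plain_matroid_scheme.intro matroid_scheme_S)

text \<open>An atom of \<open>S\<close> is a pair of \<open>{b}\<close> and \<open>b\<close>. An
  element above it of rank 1 has second coordinate \<open>b\<close>, and the only atom under
  \<open>b\<close> is \<open>b\<close>.\<close>

lemma simple_S: "simple_matroid_scheme S \<rho>"
  unfolding simple_matroid_scheme_def
proof (intro conjI ballI matroid_scheme_S)
  fix s assume s: "s \<in> atoms S"
  then obtain b where sc: "s \<in> carrier S" and b: "\<alpha> s = {b}" by (auto simp: S.atoms_label)
  have bP: "b \<in> atoms P" "b \<in> carrier P" using label(1)[OF sc] b by (auto simp: atoms_def)
  have sb: "\<sigma> s = b" using label(2)[OF sc] b joins_atom[OF bP(1)] by simp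
  have rs: "\<rho> s = 1" "poset_rank P b = 1" using rho_S[OF sc] sb bP by (auto simp: atoms_def)
  then show "\<not> loop S \<rho> s" by (simp add: loop_def)
  have "t = s" if t: "t \<in> carrier S" "s \<sqsubseteq>\<^bsub>S\<^esub> t" "\<rho> t = \<rho> s" for t
  proof -
    have st: "\<alpha> s \<subseteq> \<alpha> t" "b \<sqsubseteq> \<sigma> t" using le_S[OF sc t(1)] t sb by auto
    have tb: "\<sigma> t = b" using equal_rank[OF bP(2) label(3)[OF t(1)] st(2)] rs t rho_S by simp
    have "a = b" if a: "a \<in> \<alpha> t" for a
    proof -
      have "a \<sqsubseteq> b" using joins_atoms(2)[OF label(1,2)[OF t(1)] a] tb by simp
      moreover have "a \<in> carrier P" "poset_rank P a = 1"
        using label(1)[OF t(1)] a by (auto simp: atoms_def)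
      ultimately show ?thesis using equal_rank bP rs by simp
    qed
    then have "\<alpha> t \<subseteq> \<alpha> s" unfolding b by blast
    then have "\<alpha> t = \<alpha> s" using st(1) by (rule equalityI)
    then show ?thesis using e_inj t(1) sc sb tb by simp
  qed
  then show "s \<in> flats S \<rho>" using M.flat_iff sc by blast
qed

text \<open>The flats are the saturated pairs, those whose first coordinate consists of all atoms
  under the second: saturating a pair keeps its rank, and a saturated pair cannot grow without
  changing its second coordinate.\<close>

lemma flat_poset_S: "poset_isomorphic P (flat_poset S \<rho>)"
proof -
  let ?A = "\<lambda>y. {a \<in> atoms P. a \<sqsubseteq> y}"
  have "\<forall>y\<in>carrier P. \<exists>s. s \<in> carrier S \<and> \<alpha> s = ?A y \<and> \<sigma> s = y"
  proof
    fix y assume "y \<in> carrier P"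
    then show "\<exists>s. s \<in> carrier S \<and> \<alpha> s = ?A y \<and> \<sigma> s = y"
      using decode[OF _ joins_atoms_below[of y]] by auto
  qed
  then obtain f where "\<forall>y\<in>carrier P. f y \<in> carrier S \<and> \<alpha> (f y) = ?A y \<and> \<sigma> (f y) = y"
    by (rule bchoice[THEN exE])
  then have f: "f y \<in> carrier S" "\<alpha> (f y) = ?A y" "\<sigma> (f y) = y" if "y \<in> carrier P" for y
    using that by auto
  have sub: "\<alpha> t \<subseteq> ?A (\<sigma> t)" if "t \<in> carrier S" for t
    using label(1)[OF that] joins_atoms(2)[OF label(1,2)[OF that]] by blast
  have le: "f x \<sqsubseteq>\<^bsub>S\<^esub> f y \<longleftrightarrow> x \<sqsubseteq> y" if x: "x \<in> carrier P" and y: "y \<in> carrier P" for x y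
    using le_S[OF f(1)[OF x] f(1)[OF y]] f[OF x] f[OF y] le_trans[of _ x y] x y by (auto simp: atoms_def)
  have "f y \<in> flats S \<rho>" if y: "y \<in> carrier P" for y
  proof -
    have "t = f y" if t: "t \<in> carrier S" "f y \<sqsubseteq>\<^bsub>S\<^esub> t" "\<rho> t = \<rho> (f y)" for t
    proof -
      have *: "?A y \<subseteq> \<alpha> t" "y \<sqsubseteq> \<sigma> t" using le_S[OF f(1)[OF y] t(1)] t f[OF y] by auto
      have "\<sigma> t = y"
        using equal_rank[OF y label(3)[OF t(1)] *(2)] t rho_S f[OF y] by simp
      then show ?thesis using e_inj[OF t(1) f(1)[OF y]] sub[OF t(1)] * f[OF y] by auto
    qed
    then show ?thesis using M.flat_iff f(1)[OF y] by blast
  qed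
  moreover have "\<exists>y\<in>carrier P. f y = s" if s: "s \<in> flats S \<rho>" for s
  proof -
    have sc: "s \<in> carrier S" using s by (rule M.flat_closed)
    note y = label(3)[OF sc]
    have "s \<sqsubseteq>\<^bsub>S\<^esub> f (\<sigma> s)" using le_S[OF sc f(1)[OF y]] sub[OF sc] f[OF y] y by simp
    then have "f (\<sigma> s) = s" using M.flat_iff[of s] s f[OF y] rho_S sc by simp
    then show ?thesis using y by blast
  qed
  ultimately have "f ` carrier P = flats S \<rho>" by blast
  moreover have "inj_on f (carrier P)"
    by (rule inj_onI) (metis f(3))
  moreover have "weak_partial_order (flat_poset S \<rho>)"
    unfolding flat_poset_def
    using weak_partial_order_subset S.weak_partial_order_axioms M.flat_closed by blast
  ultimately show ?thesis
    unfolding poset_isomorphic_def poset_iso_def order_emb_def bij_betw_def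
    using le weak_partial_order_axioms by (intro exI[of _ f]) simp
qed

end

text \<open>The pairs live in a type depending on that of \<open>P\<close>; being finite in number,
  they are copied injectively into \<open>nat\<close>, and \<open>e\<close> undoes the
  copying.\<close>

lemma encoding_exists:
  assumes "finite (generated_elements P)"
  shows "\<exists>(S :: nat gorder) \<rho> e. encodes P S \<rho> e \<and> eq S = (=)"
proof -
  let ?G = "generated_elements P"
  obtain h :: "_ \<Rightarrow> nat" where h: "inj_on h ?G"
    using finite_imp_inj_to_nat_seg[OF assms] by blast
  let ?e = "the_inv_into ?G h"
  let ?S = "\<lparr>carrier = h ` ?G, eq = (=),
    le = (\<lambda>m n. fst (?e m) \<subseteq> fst (?e n) \<and> snd (?e m) \<sqsubseteq>\<^bsub>P\<^esub> snd (?e n))\<rparr>"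
  have "bij_betw ?e (h ` ?G) ?G"
    by (rule bij_betw_the_inv_into) (use h in \<open>simp add: bij_betw_def\<close>)
  then have "encodes P ?S (\<lambda>n. poset_rank P (snd (?e n))) ?e"
    by (simp add: encodes_def)
  then show ?thesis by (intro exI[of _ ?S]) auto
qed

text \<open>Types cannot be quantified within a formula. Existence is therefore claimed over
  \<open>nat\<close>, which has room for a copy of every finite scheme, while the converse and
  uniqueness are claimed for schemes over arbitrary types.\<close>

theorem theorem9p6:
  fixes P :: "'a gorder"
  assumes "partial_order P" and "finite (carrier P)"
  shows
    "(geometric_poset P \<longleftrightarrow>
       (\<exists>(S :: nat gorder) \<rho>. matroid_scheme S \<rho> \<and> poset_isomorphic P (flat_poset S \<rho>))) \<and>
     (\<forall>(S :: 'b gorder) \<rho>.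
       matroid_scheme S \<rho> \<and> poset_isomorphic P (flat_poset S \<rho>) \<longrightarrow> geometric_poset P) \<and>
     (geometric_poset P \<longrightarrow>
       (\<exists>(S :: nat gorder) \<rho>.
          simple_matroid_scheme S \<rho> \<and> poset_isomorphic P (flat_poset S \<rho>)) \<and>
       (\<forall>(S :: 'b gorder) \<rho> (S' :: 'c gorder) \<rho>'.
          simple_matroid_scheme S \<rho> \<and> poset_isomorphic P (flat_poset S \<rho>) \<and>
          simple_matroid_scheme S' \<rho>' \<and> poset_isomorphic P (flat_poset S' \<rho>') \<longrightarrow>
          matroid_scheme_isomorphic S \<rho> S' \<rho>'))"
proof (intro conjI impI iffI allI)
  assume g: "geometric_poset P"
  then interpret finite_geometric_poset P
    using assms(2) by (simp add: finite_geometric_poset.intro finite_geometric_poset_axioms.intro)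
  obtain S :: "nat gorder" and \<rho> e where "encodes P S \<rho> e" "eq S = (=)"
    using encoding_exists[OF generated_elements_finite] by blast
  then interpret geometric_encoding P S \<rho> e by unfold_locales
  show "\<exists>(S :: nat gorder) \<rho>. matroid_scheme S \<rho> \<and> poset_isomorphic P (flat_poset S \<rho>)"
    using matroid_scheme_S flat_poset_S by blast
  show "\<exists>(S :: nat gorder) \<rho>. simple_matroid_scheme S \<rho> \<and> poset_isomorphic P (flat_poset S \<rho>)"
    using simple_S flat_poset_S by blast
next
  assume "\<exists>(S :: nat gorder) \<rho>. matroid_scheme S \<rho> \<and> poset_isomorphic P (flat_poset S \<rho>)"
  then show "geometric_poset P"
    using flat_representationI[OF assms(1)] flat_representation.geometric_P by blast
next
  fix S :: "'b gorder" and \<rho>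
  assume "matroid_scheme S \<rho> \<and> poset_isomorphic P (flat_poset S \<rho>)"
  then show "geometric_poset P"
    using flat_representationI[OF assms(1)] flat_representation.geometric_P by blast
next
  fix S :: "'b gorder" and \<rho> and S' :: "'c gorder" and \<rho>'
  assume a: "simple_matroid_scheme S \<rho> \<and> poset_isomorphic P (flat_poset S \<rho>) \<and>
    simple_matroid_scheme S' \<rho>' \<and> poset_isomorphic P (flat_poset S' \<rho>')"
  then have m: "matroid_scheme S \<rho>" "matroid_scheme S' \<rho>'" by (auto simp: simple_matroid_scheme_def)
  obtain f f' where f: "flat_representation S \<rho> P f" "flat_representation S' \<rho>' P f'"
    using flat_representationI[OF assms(1)] m a by metis
  obtain e e' where "encodes P S \<rho> e" "encodes P S' \<rho>' e'"
    using f[THEN flat_representation.simple_encodes] a by blast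
  moreover have "weak_partial_order S" "weak_partial_order S'"
    using m[THEN matroid_scheme.axioms(1)] simplicial_poset.axioms(1) ranked_poset.axioms(1)
      partial_order.axioms(1) by blast+
  ultimately show "matroid_scheme_isomorphic S \<rho> S' \<rho>'" by (rule encodes_isomorphic)
qed

end
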